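(* Let $(M,\varphi,\xi,\eta,g)$ be a $(2n+1)$-dimensional almost contact manifold with Norden metric belonging to the class $\mathcal{F}_1\oplus\mathcal{F}_2\oplus\mathcal{F}_4\oplus\mathcal{F}_5\oplus\mathcal{F}_6$, i.e. satisfying $N=0$ and $\mathrm{d}\eta=0$, and let $\nabla$ be the Levi-Civita connection of $g$. Then the linear connection $\nabla'$ defined by $$ \nabla'_xy=\nabla_xy+\tfrac14\big\{2(\nabla_x\varphi)\varphi y+(\nabla_y\varphi)\varphi x-(\nabla_{\varphi y}\varphi)x+2\big((\nabla_x\eta)y\big)\xi-3\eta(x)\nabla_y\xi-4\eta(y)\nabla_x\xi\big\} $$ is a symmetric (i.e. torsion-free) almost $\varphi$-connection, i.e. its torsion vanishes and $\nabla'\varphi=0$.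
   Context: An almost contact manifold with Norden metric $(M,\varphi,\xi,\eta,g)$ is a smooth $(2n+1)$-dimensional manifold $M$ with an endomorphism $\varphi$ of the tangent bundle, a vector field $\xi$, a 1-form $\eta$ and a pseudo-Riemannian metric $g$ such that $\varphi^2x=-x+\eta(x)\xi$, $\eta(\xi)=1$, $g(\varphi x,\varphi y)=-g(x,y)+\eta(x)\eta(y)$ for all vector fields $x,y$. (Consequently $\varphi\xi=0$, $\eta\circ\varphi=0$, $\eta(x)=g(x,\xi)$, $g(\varphi x,y)=g(x,\varphi y)$.) The Nijenhuis tensor of the almost contact structure is $$N(x,y)=\varphi^2[x,y]+[\varphi x,\varphi y]-\varphi[\varphi x,y]-\varphi[x,\varphi y]+\big((\nabla_x\eta)y-(\nabla_y\eta)x\big)\xi;$$ the manifold is normal if $N=0$. The condition $\mathrm{d}\eta=0$ means $(\nabla_x\eta)y=(\nabla_y\eta)x$ for all $x,y$. The class $\mathcal{F}_1\oplus\mathcal{F}_2\oplus\mathcal{F}_4\oplus\mathcal{F}_5\oplus\mathcal{F}_6$ (in the Ganchev–Mihova–Gribachev classification) is the class of almost contact manifolds with Norden metric satisfying $N=0$ and $\mathrm{d}\eta=0$. A linear connection $\nabla'$ is called an almost $\varphi$-connection if $\nabla'\varphi=0$. *)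

theory Defs
  imports "HOL-Analysis.Analysis" "HOL-Library.Function_Algebras"
begin

section \<open>Smooth manifolds\<close>

text \<open>
  \<open>Ck_on k S f\<close> is meant for open \<open>S\<close>. Differentiability already gives continuity, and
  \<open>frechet_derivative f (at x) v\<close> is the derivative of \<open>f\<close> at \<open>x\<close> in direction \<open>v\<close>.
\<close>

primrec Ck_on ::
  "nat \<Rightarrow> 'a::euclidean_space set \<Rightarrow> ('a \<Rightarrow> 'b::real_normed_vector) \<Rightarrow> bool" where
  "Ck_on 0 S f \<longleftrightarrow> continuous_on S f"
| "Ck_on (Suc k) S f \<longleftrightarrow>
     (\<forall>x\<in>S. f differentiable (at x)) \<and>
     (\<forall>v. Ck_on k S (\<lambda>x. frechet_derivative f (at x) v))"

definition smooth_on :: "'a::euclidean_space set \<Rightarrow> ('a \<Rightarrow> 'b::real_normed_vector) \<Rightarrow> bool" where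
  "smooth_on S f \<longleftrightarrow> (\<forall>k. Ck_on k S f)"

text \<open>
  The manifold is the whole type \<open>'m\<close> (Hausdorff and second countable through its sort); an atlas
  is a set of pairs (domain, coordinate map) with values in the Euclidean space \<open>'a\<close>, whose
  dimension is the dimension of the manifold.
\<close>

type_synonym ('m, 'a) atlas = "('m set \<times> ('m \<Rightarrow> 'a)) set"

definition smooth_atlas ::
  "('m::{t2_space, second_countable_topology}, 'a::euclidean_space) atlas \<Rightarrow> bool" where
  "smooth_atlas A \<longleftrightarrow>
     (\<Union>(U, c)\<in>A. U) = UNIV \<and>
     (\<forall>(U, c)\<in>A. open U \<and> open (c ` U) \<and> homeomorphism U (c ` U) c (inv_into U c)) \<and>
     (\<forall>(U, c)\<in>A. \<forall>(V, d)\<in>A. smooth_on (c ` (U \<inter> V)) (d \<circ> inv_into U c))"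

definition smooth_functions ::
  "('m::{t2_space, second_countable_topology}, 'a::euclidean_space) atlas \<Rightarrow> ('m \<Rightarrow> real) set" where
  "smooth_functions A = {f. \<forall>(U, c)\<in>A. smooth_on (c ` U) (f \<circ> inv_into U c)}"


section \<open>Tangent vectors and vector fields\<close>

text \<open>
  Tangent vectors at \<open>p\<close> are the derivations at \<open>p\<close> of the algebra of smooth functions. As HOL
  functions are total, a derivation is extended by 0 to functions that are not smooth, so that two
  tangent vectors are equal iff they are equal in HOL. The vector space structure of
  tangent vectors and of vector fields (\<open>+\<close>, \<open>-\<close>, \<open>0\<close>) is the pointwise one
  of \<^theory>\<open>HOL-Library.Function_Algebras\<close>.
\<close>

type_synonym 'm tvec = "('m \<Rightarrow> real) \<Rightarrow> real"
type_synonym 'm vfield = "'m \<Rightarrow> 'm tvec"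

definition tangent_space ::
  "('m::{t2_space, second_countable_topology}, 'a::euclidean_space) atlas \<Rightarrow> 'm \<Rightarrow> 'm tvec set" where
  "tangent_space A p = {v.
     (\<forall>f. f \<notin> smooth_functions A \<longrightarrow> v f = 0) \<and>
     (\<forall>f\<in>smooth_functions A. \<forall>h\<in>smooth_functions A. v (\<lambda>q. f q + h q) = v f + v h) \<and>
     (\<forall>a. \<forall>f\<in>smooth_functions A. v (\<lambda>q. a * f q) = a * v f) \<and>
     (\<forall>f\<in>smooth_functions A. \<forall>h\<in>smooth_functions A.
        v (\<lambda>q. f q * h q) = f p * v h + h p * v f)}"

definition tscale :: "real \<Rightarrow> 'm tvec \<Rightarrow> 'm tvec" (infixr "*\<^sub>T" 75) where
  "a *\<^sub>T v = (\<lambda>f. a * v f)"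

definition fscale :: "('m \<Rightarrow> real) \<Rightarrow> 'm vfield \<Rightarrow> 'm vfield" (infixr "*\<^sub>F" 75) where
  "h *\<^sub>F X = (\<lambda>p. h p *\<^sub>T X p)"

definition vector_fields ::
  "('m::{t2_space, second_countable_topology}, 'a::euclidean_space) atlas \<Rightarrow> 'm vfield set" where
  "vector_fields A = {X.
     (\<forall>p. X p \<in> tangent_space A p) \<and>
     (\<forall>f\<in>smooth_functions A. (\<lambda>p. X p f) \<in> smooth_functions A)}"

definition lie_bracket :: "'m vfield \<Rightarrow> 'm vfield \<Rightarrow> 'm vfield" where
  "lie_bracket X Y = (\<lambda>p f. X p (\<lambda>q. Y q f) - Y p (\<lambda>q. X q f))"


section \<open>Tensor fields\<close>

text \<open>
  An endomorphism field, a 1-form and a bilinear form are families of (bi)linear maps on the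
  tangent spaces; smoothness means that smooth vector fields are sent to smooth vector fields
  respectively smooth functions.
\<close>

definition tensor_app :: "('m \<Rightarrow> 'm tvec \<Rightarrow> 'b) \<Rightarrow> 'm vfield \<Rightarrow> ('m \<Rightarrow> 'b)" (infixr "\<cdot>" 85) where
  "T \<cdot> X = (\<lambda>p. T p (X p))"

definition tensor_app2 ::
  "('m \<Rightarrow> 'm tvec \<Rightarrow> 'm tvec \<Rightarrow> 'b) \<Rightarrow> 'm vfield \<Rightarrow> 'm vfield \<Rightarrow> ('m \<Rightarrow> 'b)" where
  "tensor_app2 T X Y = (\<lambda>p. T p (X p) (Y p))"

definition endomorphism_field ::
  "('m::{t2_space, second_countable_topology}, 'a::euclidean_space) atlas
     \<Rightarrow> ('m \<Rightarrow> 'm tvec \<Rightarrow> 'm tvec) \<Rightarrow> bool" where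
  "endomorphism_field A \<phi> \<longleftrightarrow>
     (\<forall>p. \<forall>v\<in>tangent_space A p. \<phi> p v \<in> tangent_space A p) \<and>
     (\<forall>p. \<forall>v\<in>tangent_space A p. \<forall>w\<in>tangent_space A p. \<phi> p (v + w) = \<phi> p v + \<phi> p w) \<and>
     (\<forall>p a. \<forall>v\<in>tangent_space A p. \<phi> p (a *\<^sub>T v) = a *\<^sub>T \<phi> p v) \<and>
     (\<forall>X\<in>vector_fields A. \<phi> \<cdot> X \<in> vector_fields A)"

definition one_form ::
  "('m::{t2_space, second_countable_topology}, 'a::euclidean_space) atlas
     \<Rightarrow> ('m \<Rightarrow> 'm tvec \<Rightarrow> real) \<Rightarrow> bool" where
  "one_form A \<eta> \<longleftrightarrow>
     (\<forall>p. \<forall>v\<in>tangent_space A p. \<forall>w\<in>tangent_space A p. \<eta> p (v + w) = \<eta> p v + \<eta> p w) \<and>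
     (\<forall>p a. \<forall>v\<in>tangent_space A p. \<eta> p (a *\<^sub>T v) = a * \<eta> p v) \<and>
     (\<forall>X\<in>vector_fields A. \<eta> \<cdot> X \<in> smooth_functions A)"

text \<open>
  Linearity in the second argument follows from symmetry. No condition on the signature is imposed;
  for a Norden metric on an almost contact manifold of dimension \<open>2n+1\<close> it is
  automatically \<open>(n+1, n)\<close>, in particular constant.
\<close>

definition pseudo_riemannian_metric ::
  "('m::{t2_space, second_countable_topology}, 'a::euclidean_space) atlas
     \<Rightarrow> ('m \<Rightarrow> 'm tvec \<Rightarrow> 'm tvec \<Rightarrow> real) \<Rightarrow> bool" where
  "pseudo_riemannian_metric A g \<longleftrightarrow>
     (\<forall>p. \<forall>u\<in>tangent_space A p. \<forall>v\<in>tangent_space A p. \<forall>w\<in>tangent_space A p.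
        g p (u + v) w = g p u w + g p v w) \<and>
     (\<forall>p a. \<forall>v\<in>tangent_space A p. \<forall>w\<in>tangent_space A p. g p (a *\<^sub>T v) w = a * g p v w) \<and>
     (\<forall>p. \<forall>v\<in>tangent_space A p. \<forall>w\<in>tangent_space A p. g p v w = g p w v) \<and>
     (\<forall>p. \<forall>v\<in>tangent_space A p. (\<forall>w\<in>tangent_space A p. g p v w = 0) \<longrightarrow> v = 0) \<and>
     (\<forall>X\<in>vector_fields A. \<forall>Y\<in>vector_fields A. tensor_app2 g X Y \<in> smooth_functions A)"


section \<open>Linear connections\<close>

text \<open>\<open>nabla x y\<close> is \<open>\<nabla>\<^sub>x y\<close>; only its values on smooth vector fields matter.\<close>

definition linear_connection ::
  "('m::{t2_space, second_countable_topology}, 'a::euclidean_space) atlas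
     \<Rightarrow> ('m vfield \<Rightarrow> 'm vfield \<Rightarrow> 'm vfield) \<Rightarrow> bool" where
  "linear_connection A nabla \<longleftrightarrow>
     (\<forall>x\<in>vector_fields A. \<forall>y\<in>vector_fields A. nabla x y \<in> vector_fields A) \<and>
     (\<forall>x\<in>vector_fields A. \<forall>y\<in>vector_fields A. \<forall>z\<in>vector_fields A.
        nabla (x + y) z = nabla x z + nabla y z) \<and>
     (\<forall>h\<in>smooth_functions A. \<forall>x\<in>vector_fields A. \<forall>y\<in>vector_fields A.
        nabla (h *\<^sub>F x) y = h *\<^sub>F nabla x y) \<and>
     (\<forall>x\<in>vector_fields A. \<forall>y\<in>vector_fields A. \<forall>z\<in>vector_fields A.
        nabla x (y + z) = nabla x y + nabla x z) \<and>
     (\<forall>h\<in>smooth_functions A. \<forall>x\<in>vector_fields A. \<forall>y\<in>vector_fields A.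
        nabla x (h *\<^sub>F y) = (\<lambda>p. x p h) *\<^sub>F y + h *\<^sub>F nabla x y)"

definition torsion ::
  "('m vfield \<Rightarrow> 'm vfield \<Rightarrow> 'm vfield) \<Rightarrow> 'm vfield \<Rightarrow> 'm vfield \<Rightarrow> 'm vfield" where
  "torsion nabla x y = nabla x y - nabla y x - lie_bracket x y"

definition symmetric_connection ::
  "('m::{t2_space, second_countable_topology}, 'a::euclidean_space) atlas
     \<Rightarrow> ('m vfield \<Rightarrow> 'm vfield \<Rightarrow> 'm vfield) \<Rightarrow> bool" where
  "symmetric_connection A nabla \<longleftrightarrow>
     linear_connection A nabla \<and>
     (\<forall>x\<in>vector_fields A. \<forall>y\<in>vector_fields A. torsion nabla x y = 0)"

definition levi_civita ::
  "('m::{t2_space, second_countable_topology}, 'a::euclidean_space) atlas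
     \<Rightarrow> ('m \<Rightarrow> 'm tvec \<Rightarrow> 'm tvec \<Rightarrow> real) \<Rightarrow> ('m vfield \<Rightarrow> 'm vfield \<Rightarrow> 'm vfield) \<Rightarrow> bool" where
  "levi_civita A g nabla \<longleftrightarrow>
     symmetric_connection A nabla \<and>
     (\<forall>x\<in>vector_fields A. \<forall>y\<in>vector_fields A. \<forall>z\<in>vector_fields A.
        (\<lambda>p. x p (tensor_app2 g y z)) =
        tensor_app2 g (nabla x y) z + tensor_app2 g y (nabla x z))"

text \<open>\<open>(\<nabla>\<^sub>x \<phi>) y = \<nabla>\<^sub>x (\<phi> y) - \<phi> (\<nabla>\<^sub>x y)\<close> and \<open>(\<nabla>\<^sub>x \<eta>) y = x (\<eta> y) - \<eta> (\<nabla>\<^sub>x y)\<close>\<close>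

definition cov_endo ::
  "('m vfield \<Rightarrow> 'm vfield \<Rightarrow> 'm vfield) \<Rightarrow> ('m \<Rightarrow> 'm tvec \<Rightarrow> 'm tvec)
     \<Rightarrow> 'm vfield \<Rightarrow> 'm vfield \<Rightarrow> 'm vfield" where
  "cov_endo nabla \<phi> x y = nabla x (\<phi> \<cdot> y) - \<phi> \<cdot> nabla x y"

definition cov_form ::
  "('m vfield \<Rightarrow> 'm vfield \<Rightarrow> 'm vfield) \<Rightarrow> ('m \<Rightarrow> 'm tvec \<Rightarrow> real)
     \<Rightarrow> 'm vfield \<Rightarrow> 'm vfield \<Rightarrow> ('m \<Rightarrow> real)" where
  "cov_form nabla \<eta> x y = (\<lambda>p. x p (\<eta> \<cdot> y)) - \<eta> \<cdot> nabla x y"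

definition almost_phi_connection ::
  "('m::{t2_space, second_countable_topology}, 'a::euclidean_space) atlas
     \<Rightarrow> ('m \<Rightarrow> 'm tvec \<Rightarrow> 'm tvec) \<Rightarrow> ('m vfield \<Rightarrow> 'm vfield \<Rightarrow> 'm vfield) \<Rightarrow> bool" where
  "almost_phi_connection A \<phi> nabla \<longleftrightarrow>
     linear_connection A nabla \<and>
     (\<forall>x\<in>vector_fields A. \<forall>y\<in>vector_fields A. cov_endo nabla \<phi> x y = 0)"


section \<open>Almost contact manifolds with Norden metric\<close>

definition almost_contact_norden ::
  "nat \<Rightarrow> ('m::{t2_space, second_countable_topology}, 'a::euclidean_space) atlas
     \<Rightarrow> ('m \<Rightarrow> 'm tvec \<Rightarrow> 'm tvec) \<Rightarrow> 'm vfield \<Rightarrow> ('m \<Rightarrow> 'm tvec \<Rightarrow> real)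
     \<Rightarrow> ('m \<Rightarrow> 'm tvec \<Rightarrow> 'm tvec \<Rightarrow> real) \<Rightarrow> bool" where
  "almost_contact_norden n A \<phi> \<xi> \<eta> g \<longleftrightarrow>
     DIM('a) = 2 * n + 1 \<and>
     smooth_atlas A \<and>
     endomorphism_field A \<phi> \<and>
     \<xi> \<in> vector_fields A \<and>
     one_form A \<eta> \<and>
     pseudo_riemannian_metric A g \<and>
     (\<forall>x\<in>vector_fields A. \<phi> \<cdot> \<phi> \<cdot> x = - x + (\<eta> \<cdot> x) *\<^sub>F \<xi>) \<and>
     \<eta> \<cdot> \<xi> = (\<lambda>p. 1) \<and>
     (\<forall>x\<in>vector_fields A. \<forall>y\<in>vector_fields A.
        tensor_app2 g (\<phi> \<cdot> x) (\<phi> \<cdot> y) = - tensor_app2 g x y + (\<eta> \<cdot> x) * (\<eta> \<cdot> y))"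

definition nijenhuis ::
  "('m vfield \<Rightarrow> 'm vfield \<Rightarrow> 'm vfield) \<Rightarrow> ('m \<Rightarrow> 'm tvec \<Rightarrow> 'm tvec) \<Rightarrow> 'm vfield
     \<Rightarrow> ('m \<Rightarrow> 'm tvec \<Rightarrow> real) \<Rightarrow> 'm vfield \<Rightarrow> 'm vfield \<Rightarrow> 'm vfield" where
  "nijenhuis nabla \<phi> \<xi> \<eta> x y =
     \<phi> \<cdot> \<phi> \<cdot> lie_bracket x y + lie_bracket (\<phi> \<cdot> x) (\<phi> \<cdot> y)
     - \<phi> \<cdot> lie_bracket (\<phi> \<cdot> x) y - \<phi> \<cdot> lie_bracket x (\<phi> \<cdot> y)
     + (cov_form nabla \<eta> x y - cov_form nabla \<eta> y x) *\<^sub>F \<xi>"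

text \<open>
  The class \<open>F\<^sub>1 \<oplus> F\<^sub>2 \<oplus> F\<^sub>4 \<oplus> F\<^sub>5 \<oplus> F\<^sub>6\<close>: \<open>N = 0\<close> and \<open>d\<eta> = 0\<close>. Here \<open>nabla\<close> is the
  Levi-Civita connection of the metric.
\<close>

definition class_F12456 ::
  "('m::{t2_space, second_countable_topology}, 'a::euclidean_space) atlas
     \<Rightarrow> ('m vfield \<Rightarrow> 'm vfield \<Rightarrow> 'm vfield) \<Rightarrow> ('m \<Rightarrow> 'm tvec \<Rightarrow> 'm tvec) \<Rightarrow> 'm vfield
     \<Rightarrow> ('m \<Rightarrow> 'm tvec \<Rightarrow> real) \<Rightarrow> bool" where
  "class_F12456 A nabla \<phi> \<xi> \<eta> \<longleftrightarrow>
     (\<forall>x\<in>vector_fields A. \<forall>y\<in>vector_fields A. nijenhuis nabla \<phi> \<xi> \<eta> x y = 0) \<and>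
     (\<forall>x\<in>vector_fields A. \<forall>y\<in>vector_fields A. cov_form nabla \<eta> x y = cov_form nabla \<eta> y x)"

end

theory Submission
  imports Defs
begin

text \<open>
  Write \<open>\<nabla>' = \<nabla> + B/4\<close>; the tensor \<open>B\<close> makes \<open>\<nabla>'\<close> a linear connection. Expressing the brackets through
  the torsion-free \<open>\<nabla>\<close> and using \<open>\<phi> (\<nabla>\<^sub>x \<phi>) y = ((\<nabla>\<^sub>x \<eta>) y) \<xi> + \<eta>(y) \<nabla>\<^sub>x \<xi> - (\<nabla>\<^sub>x \<phi>) \<phi> y\<close>, one finds
  \<open>B x y - B y x = N(x, y) = 0\<close>. The same identity reduces \<open>\<nabla>' \<phi> = 0\<close> to \<open>\<nabla>\<^sub>\<xi> \<phi> = 0\<close> and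
  \<open>\<nabla>\<^sub>\<phi>\<^sub>y \<xi> = \<phi> \<nabla>\<^sub>y \<xi>\<close>. Now \<open>N(x, \<xi>) = 0\<close> gives \<open>(\<nabla>\<^sub>\<xi> \<phi>) x = \<nabla>\<^sub>\<phi>\<^sub>x \<xi> - \<phi> \<nabla>\<^sub>x \<xi>\<close>; paired with \<open>y\<close> under \<open>g\<close>,
  the right-hand side is antisymmetric in \<open>x, y\<close> because \<open>d\<eta> = 0\<close>, while the left-hand side is
  symmetric because \<open>\<phi>\<close> is self-adjoint, so both vanish.

  Nondegeneracy of \<open>g\<close> is a statement about tangent vectors, so the last step needs every tangent
  vector, being a derivation, to extend to a vector field. This follows from Hadamard's lemma and
  a smooth bump function.
\<close>

section \<open>Functions of class \<open>C\<^sup>k\<close>\<close>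

text \<open>On an open set the two functions agree near every point, so they have the same
  derivatives there, and the induction continues with the directional derivatives.\<close>

lemma Ck_on_cong:
  assumes "open S" "\<And>x. x \<in> S \<Longrightarrow> f x = g x"
  shows "Ck_on k S f \<longleftrightarrow> Ck_on k S g"
  using assms(2)
proof (induction k arbitrary: f g)
  case 0
  then show ?case by (simp cong: continuous_on_cong)
next
  case (Suc k)
  have D: "(f has_derivative D) (at x) \<longleftrightarrow> (g has_derivative D) (at x)" if "x \<in> S" for x D
    using has_derivative_transform_within_open[OF _ assms(1) that, of f D UNIV g]
      has_derivative_transform_within_open[OF _ assms(1) that, of g D UNIV f] Suc.prems by auto
  then have "frechet_derivative f (at x) = frechet_derivative g (at x)" if "x \<in> S" for x
    using that by (simp add: frechet_derivative_def)
  then have "Ck_on k S (\<lambda>x. frechet_derivative f (at x) v) \<longleftrightarrow>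
      Ck_on k S (\<lambda>x. frechet_derivative g (at x) v)" for v
    by (intro Suc.IH) simp
  with D show ?case by (simp add: differentiable_def)
qed

lemma Ck_on_subset: "Ck_on k S f \<Longrightarrow> T \<subseteq> S \<Longrightarrow> Ck_on k T f"
  by (induction k arbitrary: f) (auto intro: continuous_on_subset)

text \<open>Continuity and differentiability are tested point by point. This is what later allows a
  chart formula and the zero function to be glued along an open cover.\<close>

lemma Ck_on_local:
  assumes "\<And>x. x \<in> S \<Longrightarrow> \<exists>T. open T \<and> x \<in> T \<and> Ck_on k T f"
  shows "Ck_on k S f"
  using assms
proof (induction k arbitrary: f)
  case 0
  have "isCont f x" if "x \<in> S" for x
    using 0[OF that] by (auto simp: continuous_on_eq_continuous_at)
  then show ?case by (simp add: continuous_at_imp_continuous_on)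
next
  case (Suc k)
  have "f differentiable (at x)" if "x \<in> S" for x
    using Suc.prems[OF that] by auto
  moreover have "Ck_on k S (\<lambda>x. frechet_derivative f (at x) v)" for v
  proof (rule Suc.IH)
    show "\<exists>T. open T \<and> x \<in> T \<and> Ck_on k T (\<lambda>x. frechet_derivative f (at x) v)" if "x \<in> S" for x
      using Suc.prems[OF that] by auto
  qed
  ultimately show ?case by simp
qed

text \<open>The base case is that differentiability implies continuity. The product rule needs this
  descent, since its summands contain undifferentiated factors.\<close>

lemma Ck_on_SucD:
  assumes "Ck_on (Suc k) S f"
  shows "Ck_on k S f"
  using assms
proof (induction k arbitrary: f)
  case 0
  then show ?case
    by (simp add: continuous_at_imp_continuous_on differentiable_imp_continuous_within)
next
  case (Suc k)
  then show ?case by simp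
qed

text \<open>Allows an explicit derivative \<open>f'\<close> in place of
  \<open>frechet_derivative\<close>; uniqueness of the derivative makes both agree on
  \<open>S\<close>.\<close>

lemma Ck_on_SucI:
  assumes "open S" "\<And>x. x \<in> S \<Longrightarrow> (f has_derivative f' x) (at x)"
    and "\<And>v. Ck_on k S (\<lambda>x. f' x v)"
  shows "Ck_on (Suc k) S f"
proof -
  have "Ck_on k S (\<lambda>x. frechet_derivative f (at x) v) \<longleftrightarrow> Ck_on k S (\<lambda>x. f' x v)" for v
    using assms(1,2) by (intro Ck_on_cong) (metis frechet_derivative_at)+
  with assms show ?thesis by (auto simp: differentiable_def)
qed

lemma Ck_on_has_derivative:
  assumes "Ck_on (Suc k) S f" "x \<in> S"
  shows "(f has_derivative frechet_derivative f (at x)) (at x)"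
  using assms by (simp add: frechet_derivative_works[symmetric])

lemma Ck_on_const:
  assumes "open S"
  shows "Ck_on k S (\<lambda>x. c)"
proof (induction k arbitrary: c)
  case (Suc k)
  then show ?case by (intro Ck_on_SucI[OF assms, where f' = "\<lambda>x v. 0"]) auto
qed simp

lemma Ck_on_add:
  assumes "open S" "Ck_on k S f" "Ck_on k S g"
  shows "Ck_on k S (\<lambda>x. f x + g x)"
  using assms(2,3)
proof (induction k arbitrary: f g)
  case 0
  then show ?case by (simp add: continuous_on_add)
next
  case (Suc k)
  show ?case
  proof (rule Ck_on_SucI[OF assms(1)])
    fix x assume "x \<in> S"
    then show "((\<lambda>x. f x + g x) has_derivative
        (\<lambda>v. frechet_derivative f (at x) v + frechet_derivative g (at x) v)) (at x)"
      by (intro has_derivative_add Suc.prems[THEN Ck_on_has_derivative])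
  next
    fix v
    show "Ck_on k S (\<lambda>x. frechet_derivative f (at x) v + frechet_derivative g (at x) v)"
      using Suc.prems by (intro Suc.IH) auto
  qed
qed

lemma Ck_on_sum:
  assumes "open S" "\<And>i. i \<in> I \<Longrightarrow> Ck_on k S (f i)"
  shows "Ck_on k S (\<lambda>x. \<Sum>i\<in>I. f i x)"
  using assms(2)
  by (induction I rule: infinite_finite_induct) (auto intro: Ck_on_const Ck_on_add assms(1))

lemma Ck_on_mult:
  fixes f g :: "'a::euclidean_space \<Rightarrow> real"
  assumes "open S" "Ck_on k S f" "Ck_on k S g"
  shows "Ck_on k S (\<lambda>x. f x * g x)"
  using assms(2,3)
proof (induction k arbitrary: f g)
  case 0
  then show ?case by (simp add: continuous_on_mult)
next
  case (Suc k)
  show ?case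
  proof (rule Ck_on_SucI[OF assms(1)])
    fix x assume "x \<in> S"
    then show "((\<lambda>x. f x * g x) has_derivative
        (\<lambda>v. f x * frechet_derivative g (at x) v + frechet_derivative f (at x) v * g x)) (at x)"
      by (intro has_derivative_mult Suc.prems[THEN Ck_on_has_derivative])
  next
    fix v
    have "Ck_on k S (\<lambda>x. frechet_derivative f (at x) v)" "Ck_on k S (\<lambda>x. frechet_derivative g (at x) v)"
      using Suc.prems by auto
    then show "Ck_on k S (\<lambda>x. f x * frechet_derivative g (at x) v + frechet_derivative f (at x) v * g x)"
      by (intro Ck_on_add[OF assms(1)] Suc.IH Suc.prems[THEN Ck_on_SucD])
  qed
qed

lemma Ck_on_inner_const:
  assumes "open S" "Ck_on k S f"
  shows "Ck_on k S (\<lambda>x. f x \<bullet> b)"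
  using assms(2)
proof (induction k arbitrary: f)
  case 0
  then show ?case by (auto intro!: continuous_on_inner)
next
  case (Suc k)
  show ?case
  proof (rule Ck_on_SucI[OF assms(1)])
    fix x assume "x \<in> S"
    then show "((\<lambda>x. f x \<bullet> b) has_derivative (\<lambda>v. frechet_derivative f (at x) v \<bullet> b)) (at x)"
      by (intro has_derivative_inner_left Ck_on_has_derivative[OF Suc.prems])
  next
    fix v
    show "Ck_on k S (\<lambda>x. frechet_derivative f (at x) v \<bullet> b)"
      using Suc.prems by (intro Suc.IH) auto
  qed
qed

lemma Ck_on_inner_shift:
  assumes "open S"
  shows "Ck_on k S (\<lambda>x. (x - a) \<bullet> b)"
proof (cases k)
  case 0
  then show ?thesis by (simp add: continuous_on_inner continuous_on_diff)
next
  case (Suc j)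
  show ?thesis unfolding Suc
    by (rule Ck_on_SucI[OF assms, where f' = "\<lambda>x v. v \<bullet> b"])
      (auto intro!: derivative_eq_intros Ck_on_const assms)
qed

section \<open>Calculus of smooth functions on open sets\<close>

lemma smooth_on_frechet_derivative:
  "smooth_on S f \<Longrightarrow> smooth_on S (\<lambda>x. frechet_derivative f (at x) v)"
  unfolding smooth_on_def by (metis Ck_on.simps(2))

lemma smooth_on_has_derivative:
  "smooth_on S f \<Longrightarrow> x \<in> S \<Longrightarrow> (f has_derivative frechet_derivative f (at x)) (at x)"
  unfolding smooth_on_def using Ck_on_has_derivative by blast

lemma smooth_on_subset: "smooth_on S f \<Longrightarrow> T \<subseteq> S \<Longrightarrow> smooth_on T f"
  unfolding smooth_on_def using Ck_on_subset by blast

lemma smooth_on_cong: "open S \<Longrightarrow> (\<And>x. x \<in> S \<Longrightarrow> f x = g x) \<Longrightarrow> smooth_on S f \<longleftrightarrow> smooth_on S g"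
  unfolding smooth_on_def using Ck_on_cong by blast

lemma smooth_on_local:
  assumes "\<And>x. x \<in> S \<Longrightarrow> \<exists>T. open T \<and> x \<in> T \<and> smooth_on T f"
  shows "smooth_on S f"
  unfolding smooth_on_def
proof
  fix k show "Ck_on k S f"
    using assms by (intro Ck_on_local) (metis smooth_on_def)
qed

lemma smooth_on_const: "open S \<Longrightarrow> smooth_on S (\<lambda>x. c)"
  by (simp add: smooth_on_def Ck_on_const)

lemma smooth_on_add:
  "open S \<Longrightarrow> smooth_on S f \<Longrightarrow> smooth_on S g \<Longrightarrow> smooth_on S (\<lambda>x. f x + g x)"
  by (simp add: smooth_on_def Ck_on_add)

lemma smooth_on_mult:
  fixes f g :: "'a::euclidean_space \<Rightarrow> real"
  shows "open S \<Longrightarrow> smooth_on S f \<Longrightarrow> smooth_on S g \<Longrightarrow> smooth_on S (\<lambda>x. f x * g x)"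
  by (simp add: smooth_on_def Ck_on_mult)

text \<open>The chain rule gives a sum of products of components of the derivative of
  \<open>f\<close> with partial derivatives of \<open>g\<close> composed with \<open>f\<close>. The
  former are smooth by assumption and the latter fall under the induction hypothesis, so the
  induction varies only \<open>g\<close>.\<close>

lemma Ck_on_compose:
  fixes f :: "'a::euclidean_space \<Rightarrow> 'b::euclidean_space" and g :: "'b \<Rightarrow> real"
  assumes "open S" "smooth_on S f" "smooth_on T g" "f ` S \<subseteq> T"
  shows "Ck_on k S (\<lambda>x. g (f x))"
  using assms(3)
proof (induction k arbitrary: g)
  case 0
  have "continuous_on S f" "continuous_on T g"
    using assms(2) 0 by (metis Ck_on.simps(1) smooth_on_def)+
  then show ?case
    using assms(4) by (auto intro: continuous_on_compose2)
next
  case (Suc k)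
  let ?f' = "\<lambda>x. frechet_derivative f (at x)" and ?g' = "\<lambda>y. frechet_derivative g (at y)"
  have "((\<lambda>x. g (f x)) has_derivative (\<lambda>v. \<Sum>b\<in>Basis. (?f' x v \<bullet> b) * ?g' (f x) b)) (at x)"
    if "x \<in> S" for x
  proof -
    have g': "(g has_derivative ?g' (f x)) (at (f x))"
      using smooth_on_has_derivative[OF Suc.prems] that assms(4) by blast
    \<comment> \<open>Expanding in the basis turns the derivative of the composite into products of
      scalar functions, to which \<open>Ck_on_mult\<close> applies.\<close>
    have rep: "?g' (f x) u = (\<Sum>b\<in>Basis. (u \<bullet> b) * ?g' (f x) b)" for u
    proof -
      have lin: "linear (?g' (f x))" using g' by (rule has_derivative_linear)
      have "?g' (f x) u = ?g' (f x) (\<Sum>b\<in>Basis. (u \<bullet> b) *\<^sub>R b)" by (simp add: euclidean_representation)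
      also have "\<dots> = (\<Sum>b\<in>Basis. (u \<bullet> b) * ?g' (f x) b)"
        by (simp add: linear_sum[OF lin] linear_scale[OF lin])
      finally show ?thesis .
    qed
    show ?thesis
      using has_derivative_compose[OF smooth_on_has_derivative[OF assms(2) that] g']
      by (simp only: rep[of "?f' x _"])
  qed
  moreover have "Ck_on k S (\<lambda>x. \<Sum>b\<in>Basis. (?f' x v \<bullet> b) * ?g' (f x) b)" for v
    using smooth_on_frechet_derivative[OF assms(2), of v]
    by (intro Ck_on_sum Ck_on_mult Ck_on_inner_const assms(1)
        Suc.IH[OF smooth_on_frechet_derivative[OF Suc.prems]]) (simp add: smooth_on_def)
  ultimately show ?case by (rule Ck_on_SucI[OF assms(1)])
qed

lemma smooth_on_compose:
  fixes f :: "'a::euclidean_space \<Rightarrow> 'b::euclidean_space" and g :: "'b \<Rightarrow> real"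
  assumes "open S" "smooth_on S f" "smooth_on T g" "f ` S \<subseteq> T"
  shows "smooth_on S (\<lambda>x. g (f x))"
  using Ck_on_compose[OF assms] by (simp add: smooth_on_def)

section \<open>Bump functions and Hadamard's lemma\<close>

text \<open>The derivative of \<open>flat_exp n\<close> is a linear combination of members of the family.\<close>

definition flat_exp :: "nat \<Rightarrow> real \<Rightarrow> real" where
  "flat_exp n t = (if 0 < t then (1 / t) ^ n * exp (- (1 / t)) else 0)"

text \<open>From the right, the substitution s = 1/t reduces the claim to s^n / exp s tending to 0
  at infinity; on the left the function is zero.\<close>

lemma tendsto_flat_exp_0: "flat_exp n \<midarrow>0\<rightarrow> 0"
proof -
  have "((\<lambda>s::real. s ^ n / exp s) \<longlongrightarrow> 0) at_top"
    by (rule tendsto_power_div_exp_0)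
  then have "((\<lambda>t::real. inverse t ^ n / exp (inverse t)) \<longlongrightarrow> 0) (at_right 0)"
    by (rule filterlim_compose[OF _ filterlim_inverse_at_top_right])
  then have r: "(flat_exp n \<longlongrightarrow> 0) (at_right 0)"
    by (rule Lim_transform_eventually)
      (auto simp: eventually_at_right_less flat_exp_def exp_minus divide_simps
        intro!: eventually_at_rightI[of 0 1])
  have l: "(flat_exp n \<longlongrightarrow> 0) (at_left 0)"
    by (rule Lim_transform_eventually[OF tendsto_const])
      (auto simp: flat_exp_def intro!: eventually_at_leftI[of "-1" 0])
  from l r show ?thesis by (simp add: filterlim_split_at)
qed

lemma flat_exp_has_real_derivative:
  "(flat_exp n has_real_derivative (flat_exp (n + 2) t - n * flat_exp (n + 1) t)) (at t)"
proof -
  consider "t < 0" | "t = 0" | "0 < t" by linarith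
  then show ?thesis
  proof cases
    case 1
    then have "((\<lambda>_. 0) has_real_derivative (flat_exp (n + 2) t - n * flat_exp (n + 1) t)) (at t)"
      by (simp add: flat_exp_def)
    then show ?thesis
      by (rule has_field_derivative_transform_within_open[of _ _ _ "{..<0}"]) (use 1 in \<open>auto simp: flat_exp_def\<close>)
  next
    case 2
    \<comment> \<open>The difference quotient at 0 is again a member of the family, namely
      \<open>flat_exp (n + 1)\<close>.\<close>
    have "((\<lambda>h. flat_exp n h / h) \<longlongrightarrow> 0) (at 0)"
      by (rule Lim_transform_eventually[OF tendsto_flat_exp_0[of "n + 1"]])
        (auto simp: flat_exp_def eventually_at_filter)
    with 2 show ?thesis by (simp add: DERIV_def flat_exp_def)
  next
    case 3
    have "((\<lambda>t. (1 / t) ^ n) has_real_derivative - (n * (1 / t) ^ (n + 1))) (at t)"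
    proof -
      have "((\<lambda>t. 1 / t) has_real_derivative - ((1 / t)\<^sup>2)) (at t)"
        using 3 by (auto intro!: derivative_eq_intros simp: power2_eq_square)
      from DERIV_power[OF this, of n] show ?thesis
        by (cases n) (simp_all add: power2_eq_square mult_ac)
    qed
    moreover have "((\<lambda>t. exp (- (1 / t))) has_real_derivative (1 / t)\<^sup>2 * exp (- (1 / t))) (at t)"
      using 3 by (auto intro!: derivative_eq_intros simp: power2_eq_square)
    ultimately have "((\<lambda>t. (1 / t) ^ n * exp (- (1 / t))) has_real_derivative
        (1 / t) ^ n * ((1 / t)\<^sup>2 * exp (- (1 / t))) + (- (n * (1 / t) ^ (n + 1))) * exp (- (1 / t))) (at t)"
      by (rule DERIV_mult')
    then have "((\<lambda>t. (1 / t) ^ n * exp (- (1 / t))) has_real_derivative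
        (flat_exp (n + 2) t - n * flat_exp (n + 1) t)) (at t)"
      using 3 by (simp add: flat_exp_def power_add power2_eq_square mult_ac)
    then show ?thesis
      by (rule has_field_derivative_transform_within_open[of _ _ _ "{0<..}"]) (use 3 in \<open>auto simp: flat_exp_def\<close>)
  qed
qed

lemma smooth_on_flat_exp: "smooth_on UNIV (flat_exp n)"
proof -
  have "Ck_on k UNIV (flat_exp n)" for k
  proof (induction k arbitrary: n)
    case 0
    then show ?case
      using DERIV_isCont[OF flat_exp_has_real_derivative]
      by (auto intro!: continuous_at_imp_continuous_on)
  next
    case (Suc k)
    show ?case
    proof (rule Ck_on_SucI[where f' = "\<lambda>t v. (flat_exp (n + 2) t + (- n) * flat_exp (n + 1) t) * v"])
      show "(flat_exp n has_derivative (\<lambda>v. (flat_exp (n + 2) t + (- n) * flat_exp (n + 1) t) * v)) (at t)" for t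
        using flat_exp_has_real_derivative[of n t] by (simp add: has_field_derivative_def)
      show "Ck_on k UNIV (\<lambda>t. (flat_exp (n + 2) t + (- n) * flat_exp (n + 1) t) * v)" for v
        by (intro Ck_on_mult Ck_on_add Ck_on_const Suc open_UNIV)
    qed simp
  qed
  then show ?thesis by (simp add: smooth_on_def)
qed

lemma smooth_bump_function:
  fixes a :: "'a::euclidean_space"
  assumes "0 < r"
  obtains \<psi> :: "'a \<Rightarrow> real"
  where "smooth_on UNIV \<psi>" "\<psi> a = 1" "\<And>x. x \<notin> cball a r \<Longrightarrow> \<psi> x = 0"
proof
  \<comment> \<open>This is r^2 - |x - a|^2, written in coordinates so that smoothness follows from
    closure under sums and products. It is positive exactly in the open ball, which is where
    \<open>flat_exp 0\<close> of it is nonzero.\<close>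
  define q where "q = (\<lambda>x::'a. r\<^sup>2 + (\<Sum>b\<in>Basis. (-1) * (((x - a) \<bullet> b) * ((x - a) \<bullet> b))))"
  define \<psi> where "\<psi> = (\<lambda>x. 1 / flat_exp 0 (r\<^sup>2) * flat_exp 0 (q x))"
  have q: "q x = r\<^sup>2 - (norm (x - a))\<^sup>2" for x
    by (simp add: q_def sum_negf power2_norm_eq_inner euclidean_inner[of "x - a" "x - a"])
  have "smooth_on UNIV q"
    unfolding smooth_on_def q_def
    by (intro allI Ck_on_add Ck_on_sum Ck_on_mult Ck_on_const Ck_on_inner_shift open_UNIV)
  then show "smooth_on UNIV \<psi>"
    unfolding \<psi>_def
    by (intro smooth_on_mult smooth_on_const smooth_on_compose[OF _ _ smooth_on_flat_exp]) auto
  show "\<psi> a = 1"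
    using assms by (simp add: \<psi>_def q flat_exp_def)
  show "\<psi> x = 0" if "x \<notin> cball a r" for x
  proof -
    have "r\<^sup>2 \<le> (norm (x - a))\<^sup>2"
      using that assms by (intro power_mono) (auto simp: dist_norm norm_minus_commute)
    then show ?thesis by (simp add: \<psi>_def q flat_exp_def)
  qed
qed

text \<open>Differentiation under the integral sign replaces \<open>H\<close> by a directional
  derivative, and the chain rule contributes one more factor t. The class of such integrals is
  therefore closed under differentiation, which is why the weight \<open>t ^ m\<close> is included
  and \<open>m\<close> varies in the induction.\<close>

lemma Ck_on_segment_integral:
  fixes H :: "'a::euclidean_space \<Rightarrow> real"
  assumes "smooth_on (ball a r) H"
  shows "Ck_on k (ball a r) (\<lambda>x. integral (cbox 0 1) (\<lambda>t. t ^ m * H (a + t *\<^sub>R (x - a))))"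
proof -
  let ?F = "\<lambda>H m x t. t ^ m * H (a + t *\<^sub>R (x - a))"
  have in_ball: "a + t *\<^sub>R (x - a) \<in> ball a r" if "x \<in> ball a r" "t \<in> cbox 0 1" for x and t :: real
  proof -
    have "norm (t *\<^sub>R (x - a)) \<le> 1 * norm (x - a)"
      using that(2) unfolding norm_scaleR by (intro mult_right_mono) auto
    then show ?thesis
      using that(1) by (simp add: dist_norm norm_minus_commute)
  qed
  have cont: "continuous_on (ball a r \<times> cbox 0 1) (\<lambda>(x, t). ?F H m x t)"
    if "smooth_on (ball a r) H" for H :: "'a \<Rightarrow> real" and m
  proof -
    have "continuous_on (ball a r) H"
      using that by (metis Ck_on.simps(1) smooth_on_def)
    then have "continuous_on (ball a r \<times> cbox 0 1) (\<lambda>z. H (a + snd z *\<^sub>R (fst z - a)))"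
      by (rule continuous_on_compose2) (auto intro!: continuous_intros in_ball)
    then show ?thesis
      unfolding case_prod_unfold by (intro continuous_intros)
  qed
  have cont1: "continuous_on (cbox 0 1) (?F H m x)"
    if "smooth_on (ball a r) H" "x \<in> ball a r" for H :: "'a \<Rightarrow> real" and m x
  proof -
    have "continuous_on (cbox 0 1) (\<lambda>t. (\<lambda>(x, t). ?F H m x t) (x, t))"
      by (rule continuous_on_compose2[OF cont[OF that(1)]]) (use that(2) in \<open>auto intro!: continuous_intros\<close>)
    then show ?thesis by simp
  qed
  show ?thesis
    using assms
  proof (induction k arbitrary: H m)
    case 0
    show ?case
      using integral_continuous_on_param[OF cont[OF 0]] by simp
  next
    case (Suc k)
    let ?D = "\<lambda>y. frechet_derivative H (at y)"
    \<comment> \<open>The derivative of the integrand in \<open>x\<close>, packaged as a bounded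
      linear map because \<open>leibniz_rule\<close> requires this form.\<close>
    define fx where "fx x t = Blinfun (\<lambda>v. ?F (\<lambda>y. ?D y v) (m + 1) x t)" for x t
    have H': "(H has_derivative ?D y) (at y)" if "y \<in> ball a r" for y
      using smooth_on_has_derivative[OF Suc.prems that] .
    have fx: "blinfun_apply (fx x t) = (\<lambda>v. ?F (\<lambda>y. ?D y v) (m + 1) x t)"
      if "x \<in> ball a r" "t \<in> cbox 0 1" for x t
      unfolding fx_def
      by (intro bounded_linear_Blinfun_apply bounded_linear_const_mult
          has_derivative_bounded_linear[OF H'[OF in_ball[OF that]]])
    have fx_cont: "continuous_on (ball a r \<times> cbox 0 1) (\<lambda>(x, t). fx x t)"
    proof (rule continuous_on_blinfun_componentwise)
      fix i :: 'a assume "i \<in> Basis"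
      have "continuous_on (ball a r \<times> cbox 0 1) (\<lambda>(x, t). ?F (\<lambda>y. ?D y i) (m + 1) x t)"
        by (rule cont) (rule smooth_on_frechet_derivative[OF Suc.prems])
      then show "continuous_on (ball a r \<times> cbox 0 1) (\<lambda>z. blinfun_apply (case z of (x, t) \<Rightarrow> fx x t) i)"
        by (rule continuous_on_eq) (auto simp: fx)
    qed
    show ?case
    proof (rule Ck_on_SucI[OF open_ball])
      fix x assume x: "x \<in> ball a r"
      have "((\<lambda>x. integral (cbox 0 1) (?F H m x)) has_derivative integral (cbox 0 1) (fx x)) (at x within ball a r)"
      proof (rule leibniz_rule[OF _ _ fx_cont x convex_ball])
        fix z t assume z: "z \<in> ball a r" and t: "t \<in> cbox 0 (1::real)"
        have "((\<lambda>x. a + t *\<^sub>R (x - a)) has_derivative (\<lambda>v. t *\<^sub>R v)) (at z within ball a r)"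
          by (auto intro!: derivative_eq_intros)
        from has_derivative_compose[OF this H'[OF in_ball[OF z t]]]
        have "((\<lambda>x. ?F H m x t) has_derivative
            (\<lambda>v. t ^ m * ?D (a + t *\<^sub>R (z - a)) (t *\<^sub>R v))) (at z within ball a r)"
          by (rule has_derivative_mult_right)
        also have "(\<lambda>v. t ^ m * ?D (a + t *\<^sub>R (z - a)) (t *\<^sub>R v)) = blinfun_apply (fx z t)"
          using linear_scale[OF has_derivative_linear[OF H'[OF in_ball[OF z t]]]]
          by (auto simp: fx[OF z t])
        finally show "((\<lambda>x. ?F H m x t) has_derivative blinfun_apply (fx z t)) (at z within ball a r)" .
      next
        fix z assume "z \<in> ball a r"
        then show "?F H m z integrable_on cbox 0 1"
          by (intro integrable_continuous cont1 Suc.prems)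
      qed
      moreover have "blinfun_apply (integral (cbox 0 1) (fx x)) =
          (\<lambda>v. integral (cbox 0 1) (?F (\<lambda>y. ?D y v) (m + 1) x))"
      proof
        fix v
        have "continuous_on (cbox 0 1) (\<lambda>t. (\<lambda>(x, t). fx x t) (x, t))"
          by (rule continuous_on_compose2[OF fx_cont]) (use x in \<open>auto intro!: continuous_intros\<close>)
        then have "fx x integrable_on cbox 0 1"
          by (intro integrable_continuous) simp
        then have "blinfun_apply (integral (cbox 0 1) (fx x)) v =
            integral (cbox 0 1) (\<lambda>t. blinfun_apply (fx x t) v)"
          by (rule blinfun_apply_integral)
        also have "\<dots> = integral (cbox 0 1) (?F (\<lambda>y. ?D y v) (m + 1) x)"
          by (intro integral_cong) (simp add: fx[OF x])
        finally show "blinfun_apply (integral (cbox 0 1) (fx x)) v =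
            integral (cbox 0 1) (?F (\<lambda>y. ?D y v) (m + 1) x)" .
      qed
      ultimately show "((\<lambda>x. integral (cbox 0 1) (?F H m x)) has_derivative
          (\<lambda>v. integral (cbox 0 1) (?F (\<lambda>y. ?D y v) (m + 1) x))) (at x)"
        unfolding at_within_open[OF x open_ball] by (simp only:)
    next
      fix v
      show "Ck_on k (ball a r) (\<lambda>x. integral (cbox 0 1) (?F (\<lambda>y. ?D y v) (m + 1) x))"
        by (rule Suc.IH) (rule smooth_on_frechet_derivative[OF Suc.prems])
    qed
  qed
qed

text \<open>The fundamental theorem of calculus on the segment from \<open>a\<close> to
  \<open>x\<close> writes F(x) - F(a) as the integral of the derivative applied to x - a; expanding
  x - a in the basis gives the \<open>G b\<close>.\<close>

lemma Hadamard:
  fixes F :: "'a::euclidean_space \<Rightarrow> real"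
  assumes "smooth_on (ball a r) F" "0 < r"
  obtains G where "\<And>b. smooth_on (ball a r) (G b)"
    and "\<And>x. x \<in> ball a r \<Longrightarrow> F x = F a + (\<Sum>b\<in>Basis. ((x - a) \<bullet> b) * G b x)"
    and "\<And>b. G b a = frechet_derivative F (at a) b"
proof
  let ?D = "\<lambda>y. frechet_derivative F (at y)"
  \<comment> \<open>The factor \<open>t ^ 0\<close> matches the case m = 0 of
    \<open>Ck_on_segment_integral\<close>.\<close>
  define G where "G b x = integral (cbox 0 1) (\<lambda>t::real. t ^ 0 * ?D (a + t *\<^sub>R (x - a)) b)" for b x
  show "smooth_on (ball a r) (G b)" for b
    unfolding smooth_on_def G_def
    using Ck_on_segment_integral[OF smooth_on_frechet_derivative[OF assms(1)]] by blast
  show "G b a = ?D a b" for b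
    by (simp add: G_def)
  show "F x = F a + (\<Sum>b\<in>Basis. ((x - a) \<bullet> b) * G b x)" if x: "x \<in> ball a r" for x
  proof -
    have in_ball: "a + t *\<^sub>R (x - a) \<in> ball a r" if "t \<in> {0..1}" for t :: real
    proof -
      have "norm (t *\<^sub>R (x - a)) \<le> 1 * norm (x - a)"
        using that unfolding norm_scaleR by (intro mult_right_mono) auto
      then show ?thesis
        using x by (simp add: dist_norm norm_minus_commute)
    qed
    have F': "(F has_derivative ?D y) (at y)" if "y \<in> ball a r" for y
      using smooth_on_has_derivative[OF assms(1) that] .
    have "((\<lambda>t. F (a + t *\<^sub>R (x - a))) has_vector_derivative ?D (a + t *\<^sub>R (x - a)) (x - a))
        (at t within {0..1})" if "t \<in> {0..1}" for t
    proof -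
      have "((\<lambda>t. a + t *\<^sub>R (x - a)) has_derivative (\<lambda>s. s *\<^sub>R (x - a))) (at t within {0..1})"
        by (auto intro!: derivative_eq_intros)
      from has_derivative_compose[OF this F'[OF in_ball[OF that]]] show ?thesis
        by (simp add: has_vector_derivative_def
            linear_scale[OF has_derivative_linear[OF F'[OF in_ball[OF that]]]])
    qed
    then have "((\<lambda>t. ?D (a + t *\<^sub>R (x - a)) (x - a)) has_integral F x - F a) {0..1}"
      using fundamental_theorem_of_calculus[of 0 1 "\<lambda>t. F (a + t *\<^sub>R (x - a))"] by auto
    then have "F x - F a = integral {0..1} (\<lambda>t. ?D (a + t *\<^sub>R (x - a)) (x - a))"
      by (simp add: integral_unique)
    also have "\<dots> = integral {0..1} (\<lambda>t. \<Sum>b\<in>Basis. ((x - a) \<bullet> b) * ?D (a + t *\<^sub>R (x - a)) b)"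
    proof (rule integral_cong)
      fix t :: real assume t: "t \<in> {0..1}"
      have lin: "linear (?D (a + t *\<^sub>R (x - a)))"
        using has_derivative_linear[OF F'[OF in_ball[OF t]]] .
      have "?D (a + t *\<^sub>R (x - a)) (x - a) = ?D (a + t *\<^sub>R (x - a)) (\<Sum>b\<in>Basis. ((x - a) \<bullet> b) *\<^sub>R b)"
        by (simp only: euclidean_representation)
      also have "\<dots> = (\<Sum>b\<in>Basis. ((x - a) \<bullet> b) * ?D (a + t *\<^sub>R (x - a)) b)"
        by (simp only: linear_sum[OF lin] linear_scale[OF lin] real_scaleR_def)
      finally show "?D (a + t *\<^sub>R (x - a)) (x - a) = (\<Sum>b\<in>Basis. ((x - a) \<bullet> b) * ?D (a + t *\<^sub>R (x - a)) b)" .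
    qed
    also have "\<dots> = (\<Sum>b\<in>Basis. integral {0..1} (\<lambda>t. ((x - a) \<bullet> b) * ?D (a + t *\<^sub>R (x - a)) b))"
    proof (intro integral_sum integrable_continuous_interval continuous_on_mult continuous_on_const)
      fix b :: 'a
      have "continuous_on (ball a r) (\<lambda>y. ?D y b)"
        using smooth_on_frechet_derivative[OF assms(1), of b] by (metis Ck_on.simps(1) smooth_on_def)
      then show "continuous_on {0..1} (\<lambda>t. ?D (a + t *\<^sub>R (x - a)) b)"
        by (rule continuous_on_compose2) (auto intro!: continuous_intros in_ball simp del: mem_ball)
    qed simp
    also have "\<dots> = (\<Sum>b\<in>Basis. ((x - a) \<bullet> b) * G b x)"
      by (simp add: G_def)
    finally show ?thesis by simp
  qed
qed

section \<open>Extending tangent vectors to vector fields\<close>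

lemma smooth_atlasD:
  assumes "smooth_atlas A" "(U, c) \<in> A"
  shows "open U" "open (c ` U)" "homeomorphism U (c ` U) c (inv_into U c)" "inj_on c U"
    "continuous_on U c" "continuous_on (c ` U) (inv_into U c)"
proof -
  have "\<forall>(U, c)\<in>A. open U \<and> open (c ` U) \<and> homeomorphism U (c ` U) c (inv_into U c)"
    using assms(1) unfolding smooth_atlas_def by (elim conjE)
  from bspec[OF this assms(2)]
  have o: "open U \<and> open (c ` U)" and h: "homeomorphism U (c ` U) c (inv_into U c)"
    by simp_all
  from o show "open U" "open (c ` U)" by simp_all
  from h show "homeomorphism U (c ` U) c (inv_into U c)" .
  from h show "inj_on c U" by (intro inj_on_inverseI) (rule homeomorphism_apply1)
  from h show "continuous_on U c" by (rule homeomorphism_cont1)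
  from h show "continuous_on (c ` U) (inv_into U c)" by (rule homeomorphism_cont2)
qed

lemma smooth_atlas_transition:
  assumes "smooth_atlas A" "(U, c) \<in> A" "(V, d) \<in> A"
  shows "smooth_on (d ` (V \<inter> U)) (c \<circ> inv_into V d)"
proof -
  have "\<forall>(U, c)\<in>A. \<forall>(V, d)\<in>A. smooth_on (c ` (U \<inter> V)) (d \<circ> inv_into U c)"
    using assms(1) unfolding smooth_atlas_def by (elim conjE)
  from bspec[OF bspec[OF this assms(3), unfolded prod.case] assms(2), unfolded prod.case]
  show ?thesis .
qed

lemma smooth_atlas_chart:
  assumes "smooth_atlas A"
  obtains U c where "(U, c) \<in> A" "p \<in> U"
proof -
  have "(\<Union>(U, c)\<in>A. U) = UNIV"
    using assms unfolding smooth_atlas_def by (elim conjE)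
  then have "p \<in> (\<Union>(U, c)\<in>A. U)" by simp
  then show ?thesis using that by blast
qed

section \<open>The algebra of smooth functions on the manifold\<close>

lemma smooth_functionsI:
  assumes "\<And>U c. (U, c) \<in> A \<Longrightarrow> smooth_on (c ` U) (\<lambda>x. f (inv_into U c x))"
  shows "f \<in> smooth_functions A"
  using assms by (auto simp: smooth_functions_def o_def)

lemma smooth_functionsD:
  assumes "f \<in> smooth_functions A" "(U, c) \<in> A"
  shows "smooth_on (c ` U) (\<lambda>x. f (inv_into U c x))"
  using assms by (auto simp: smooth_functions_def o_def)

lemma smooth_functions_const:
  "smooth_atlas A \<Longrightarrow> (\<lambda>q. a) \<in> smooth_functions A"
  by (rule smooth_functionsI, rule smooth_on_const) (auto intro: smooth_atlasD(2))

lemma smooth_functions_add: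
  "smooth_atlas A \<Longrightarrow> f \<in> smooth_functions A \<Longrightarrow> h \<in> smooth_functions A \<Longrightarrow>
    (\<lambda>q. f q + h q) \<in> smooth_functions A"
  by (rule smooth_functionsI, rule smooth_on_add) (auto intro: smooth_atlasD(2) smooth_functionsD)

lemma smooth_functions_mult:
  "smooth_atlas A \<Longrightarrow> f \<in> smooth_functions A \<Longrightarrow> h \<in> smooth_functions A \<Longrightarrow>
    (\<lambda>q. f q * h q) \<in> smooth_functions A"
  by (rule smooth_functionsI, rule smooth_on_mult) (auto intro: smooth_atlasD(2) smooth_functionsD)

lemma smooth_functions_sum:
  assumes "smooth_atlas A" "\<And>i. i \<in> I \<Longrightarrow> f i \<in> smooth_functions A"
  shows "(\<lambda>q. \<Sum>i\<in>I. f i q) \<in> smooth_functions A"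
  using assms(2)
proof (induction I rule: infinite_finite_induct)
  case (insert i I)
  then show ?case
    using smooth_functions_add[OF assms(1), of "f i" "\<lambda>q. \<Sum>i\<in>I. f i q"] by simp
qed (simp_all add: smooth_functions_const[OF assms(1)])

section \<open>Extension by zero of functions given in a chart\<close>

definition chart_extension ::
  "'m set \<Rightarrow> ('m \<Rightarrow> 'a) \<Rightarrow> ('a \<Rightarrow> real) \<Rightarrow> 'm \<Rightarrow> real" where
  "chart_extension U c F = (\<lambda>q. if q \<in> U then F (c q) else 0)"

text \<open>The points of the chart over \<open>cball a r\<close> form a closed set
  \<open>K\<close>. The manifold is covered by the complement of \<open>K\<close>, where the
  extension is zero, and the open chart part \<open>W\<close> over \<open>ball a R\<close>, where it
  is \<open>F\<close> composed with the chart; other charts see the latter through the smooth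
  transition maps.\<close>

lemma chart_extension_smooth:
  fixes A :: "('m::{t2_space, second_countable_topology}, 'a::euclidean_space) atlas"
  assumes A: "smooth_atlas A" and c: "(U, c) \<in> A"
    and F: "smooth_on (ball a R) F" and r: "r < R" and R: "ball a R \<subseteq> c ` U"
    and zero: "\<And>x. x \<notin> cball a r \<Longrightarrow> F x = 0"
  shows "chart_extension U c F \<in> smooth_functions A"
proof -
  note C = smooth_atlasD[OF A c]
  have sub: "cball a r \<subseteq> ball a R" using r by auto
  define K where "K = inv_into U c ` cball a r"
  have "compact K"
    unfolding K_def using C(6) sub R
    by (intro compact_continuous_image compact_cball) (blast intro: continuous_on_subset)
  \<comment> \<open>Here the Hausdorff property enters. Without closedness of \<open>K\<close>, the
    zero part would not be open.\<close>
  then have "closed K" by (rule compact_imp_closed)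
  have K_iff: "q \<in> K \<longleftrightarrow> q \<in> U \<and> c q \<in> cball a r" for q
  proof
    assume "q \<in> K"
    then obtain x where x: "x \<in> cball a r" "q = inv_into U c x" unfolding K_def by blast
    then have "x \<in> c ` U" using sub R by blast
    then show "q \<in> U \<and> c q \<in> cball a r"
      unfolding x(2) using x(1) by (simp only: f_inv_into_f inv_into_into simp_thms)
  next
    assume q: "q \<in> U \<and> c q \<in> cball a r"
    then have "q = inv_into U c (c q)" by (simp only: inv_into_f_f[OF C(4)])
    then show "q \<in> K" unfolding K_def using q by blast
  qed
  define W where "W = U \<inter> c -` ball a R"
  have "open W"
    unfolding W_def by (rule continuous_open_preimage[OF C(5,1) open_ball])
  have "smooth_on (d ` V) (chart_extension U c F \<circ> inv_into V d)" if d: "(V, d) \<in> A" for V d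
  proof (rule smooth_on_local)
    note D = smooth_atlasD[OF A d]
    \<comment> \<open>The image under the chart \<open>d\<close> is a preimage under its continuous
      inverse, so it is open in the Euclidean space.\<close>
    have open_part: "open (d ` (V \<inter> B))" if "open B" for B
    proof -
      have "d ` (V \<inter> B) = d ` V \<inter> inv_into V d -` B"
        using inv_into_f_f[OF D(4)] by fastforce
      with continuous_open_preimage[OF D(6,2) that] show ?thesis by simp
    qed
    fix x assume "x \<in> d ` V"
    then obtain q where q: "q \<in> V" "x = d q" by blast
    show "\<exists>T. open T \<and> x \<in> T \<and> smooth_on T (chart_extension U c F \<circ> inv_into V d)"
    proof (cases "q \<in> K")
      case True
      then have "q \<in> W" using sub by (auto simp: K_iff W_def)
      have "smooth_on (d ` (V \<inter> U)) (c \<circ> inv_into V d)"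
        by (rule smooth_atlas_transition[OF A c d])
      then have trans: "smooth_on (d ` (V \<inter> W)) (c \<circ> inv_into V d)"
        by (rule smooth_on_subset) (auto simp: W_def)
      have "smooth_on (d ` (V \<inter> W)) (\<lambda>y. F ((c \<circ> inv_into V d) y))"
        by (rule smooth_on_compose[OF open_part[OF \<open>open W\<close>] trans F])
          (auto simp: W_def inv_into_f_f[OF D(4)])
      then have "smooth_on (d ` (V \<inter> W)) (chart_extension U c F \<circ> inv_into V d)"
        by (subst smooth_on_cong[OF open_part[OF \<open>open W\<close>]])
          (auto simp: chart_extension_def W_def inv_into_f_f[OF D(4)])
      with open_part[OF \<open>open W\<close>] q \<open>q \<in> W\<close> show ?thesis by blast
    next
      case False
      have o: "open (d ` (V \<inter> - K))"
        by (rule open_part) (use \<open>closed K\<close> in auto)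
      have "smooth_on (d ` (V \<inter> - K)) (chart_extension U c F \<circ> inv_into V d) \<longleftrightarrow>
          smooth_on (d ` (V \<inter> - K)) (\<lambda>_. 0 :: real)"
        by (rule smooth_on_cong[OF o])
          (auto simp: chart_extension_def K_iff inv_into_f_f[OF D(4)] intro!: zero)
      with o q False smooth_on_const[OF o, of "0::real"] show ?thesis by blast
    qed
  qed
  then show ?thesis by (auto simp: smooth_functions_def)
qed

section \<open>Derivations at a point\<close>

lemma tangent_spaceD:
  assumes "v \<in> tangent_space A p"
  shows "f \<notin> smooth_functions A \<Longrightarrow> v f = 0"
    and "f \<in> smooth_functions A \<Longrightarrow> h \<in> smooth_functions A \<Longrightarrow> v (\<lambda>q. f q + h q) = v f + v h"
    and "f \<in> smooth_functions A \<Longrightarrow> v (\<lambda>q. a * f q) = a * v f"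
    and "f \<in> smooth_functions A \<Longrightarrow> h \<in> smooth_functions A \<Longrightarrow>
      v (\<lambda>q. f q * h q) = f p * v h + h p * v f"
  using assms unfolding tangent_space_def by blast+

lemma tangent_space_zero:
  assumes "smooth_atlas A" "v \<in> tangent_space A p"
  shows "v (\<lambda>q. 0) = 0"
proof -
  show ?thesis
    using tangent_spaceD(3)[OF assms(2) smooth_functions_const[OF assms(1)], of 0 0] by simp
qed

lemma tangent_space_sum:
  assumes A: "smooth_atlas A" and v: "v \<in> tangent_space A p"
    and "\<And>i. i \<in> I \<Longrightarrow> f i \<in> smooth_functions A"
  shows "v (\<lambda>q. \<Sum>i\<in>I. f i q) = (\<Sum>i\<in>I. v (f i))"
  using assms(3)
proof (induction I rule: infinite_finite_induct)
  case (insert i I)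
  have "v (\<lambda>q. f i q + (\<Sum>i\<in>I. f i q)) = v (f i) + v (\<lambda>q. \<Sum>i\<in>I. f i q)"
    using insert.prems by (intro tangent_spaceD(2)[OF v] smooth_functions_sum[OF A]) auto
  with insert show ?case by simp
qed (simp_all add: tangent_space_zero[OF A v])

text \<open>By Hadamard's lemma and the Leibniz rule, a derivation at \<open>p\<close> is determined
  by its values on the coordinate functions. It is thus a directional derivative in the chart, and
  the field with the same constant direction, cut off by a bump function, extends it.\<close>

theorem tangent_vector_extends_to_vector_field:
  fixes A :: "('m::{t2_space, second_countable_topology}, 'a::euclidean_space) atlas"
  assumes A: "smooth_atlas A" and w: "w \<in> tangent_space A p"
  obtains Y where "Y \<in> vector_fields A" "Y p = w"
proof -
  obtain U c where c: "(U, c) \<in> A" and p: "p \<in> U"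
    using smooth_atlas_chart[OF A] .
  note C = smooth_atlasD[OF A c]
  define a where "a = c p"
  have "a \<in> c ` U" using p by (simp add: a_def)
  with C(2) obtain R where "0 < R" and R: "ball a R \<subseteq> c ` U"
    by (auto simp: open_contains_ball)
  define r where "r = R / 2"
  have r: "0 < r" "r < R" using \<open>0 < R\<close> by (auto simp: r_def)
  obtain \<psi> :: "'a \<Rightarrow> real" where \<psi>: "smooth_on UNIV \<psi>" "\<psi> a = 1" "\<And>x. x \<notin> cball a r \<Longrightarrow> \<psi> x = 0"
    using smooth_bump_function[OF r(1), of a] by blast
  \<comment> \<open>Multiplication by the bump function turns a function smooth near
    \<open>a\<close> in the chart into a globally smooth one with the same value at
    \<open>p\<close>.\<close>
  define E :: "('a \<Rightarrow> real) \<Rightarrow> _" where "E F = chart_extension U c (\<lambda>x. \<psi> x * F x)" for F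
  have E_smooth: "E F \<in> smooth_functions A" if "smooth_on (ball a R) F" for F
    unfolding E_def
    using \<psi>(1,3) that
    by (intro chart_extension_smooth[OF A c _ r(2) R] smooth_on_mult) (auto intro: smooth_on_subset)
  have E_p: "E F p = F a" for F
    using p \<psi>(2) by (simp add: E_def chart_extension_def a_def)
  have E_outside: "E F q = 0" if "q \<in> U \<Longrightarrow> c q \<notin> ball a R" for F q
    using that \<psi>(3)[of "c q"] r by (auto simp: E_def chart_extension_def)
  have E_in: "E F q = \<psi> (c q) * F (c q)" if "q \<in> U" for F q
    using that by (simp add: E_def chart_extension_def)
  let ?loc = "\<lambda>f. f \<circ> inv_into U c"
  have loc_smooth: "smooth_on (ball a R) (?loc f)" if "f \<in> smooth_functions A" for f
    using smooth_on_subset[OF smooth_functionsD[OF that c] R] by (simp add: o_def)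
  have loc: "?loc f (c q) = f q" if "q \<in> U" for f q
    using that by (simp add: C(4))
  let ?x = "\<lambda>b x. (x - a) \<bullet> b"
  have x_smooth: "smooth_on (ball a R) (?x b)" for b
    by (simp add: smooth_on_def Ck_on_inner_shift)
  \<comment> \<open>The components of the direction are the values of \<open>w\<close> on the
    cut-off coordinate functions centred at \<open>a\<close>.\<close>
  define e where "e = (\<Sum>b\<in>Basis. w (E (?x b)) *\<^sub>R b)"
  have key: "w f = frechet_derivative (?loc f) (at a) e" if f: "f \<in> smooth_functions A" for f
  proof -
    obtain G where G: "\<And>b. smooth_on (ball a R) (G b)"
      "\<And>x. x \<in> ball a R \<Longrightarrow> ?loc f x = ?loc f a + (\<Sum>b\<in>Basis. ?x b x * G b x)"
      "\<And>b. G b a = frechet_derivative (?loc f) (at a) b"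
      using Hadamard[OF loc_smooth[OF f] \<open>0 < R\<close>] by blast
    \<comment> \<open>The products of two cut-off functions in the Hadamard expansion carry the
      square of \<open>\<psi>\<close>. Multiplying \<open>f\<close> by the same square makes the
      expansion an identity on the whole manifold.\<close>
    define u where "u = (\<lambda>q. E (\<lambda>_. 1) q * E (\<lambda>_. 1) q)"
    have "E (\<lambda>_. 1) \<in> smooth_functions A"
      by (intro E_smooth smooth_on_const open_ball)
    then have u: "u \<in> smooth_functions A"
      unfolding u_def by (intro smooth_functions_mult A)
    have prod: "(\<lambda>q. E (?x b) q * E (G b) q) \<in> smooth_functions A" for b
      by (intro smooth_functions_mult A E_smooth x_smooth G)
    have "(\<lambda>q. u q * f q) = (\<lambda>q. f p * u q + (\<Sum>b\<in>Basis. E (?x b) q * E (G b) q))"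
    proof
      fix q
      show "u q * f q = f p * u q + (\<Sum>b\<in>Basis. E (?x b) q * E (G b) q)"
      proof (cases "q \<in> U \<and> c q \<in> ball a R")
        case True
        then have "f q = f p + (\<Sum>b\<in>Basis. ?x b (c q) * G b (c q))"
          using G(2)[of "c q"] loc[of q f] loc[OF p, of f] by (simp add: a_def)
        then show ?thesis
          using True by (simp add: u_def E_in algebra_simps sum_distrib_left)
      next
        case False
        then show ?thesis
          using E_outside[of q] by (auto simp: u_def)
      qed
    qed
    then have "w (\<lambda>q. u q * f q) = w (\<lambda>q. f p * u q) + w (\<lambda>q. \<Sum>b\<in>Basis. E (?x b) q * E (G b) q)"
      using tangent_spaceD(2)[OF w smooth_functions_mult[OF A smooth_functions_const[OF A] u]
        smooth_functions_sum[OF A prod]]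
      by simp
    moreover have "w (\<lambda>q. u q * f q) = u p * w f + f p * w u" "w (\<lambda>q. f p * u q) = f p * w u"
      using tangent_spaceD(3,4)[OF w u] f by auto
    moreover have "u p = 1" by (simp add: u_def E_p)
    \<comment> \<open>The terms \<open>f p * w u\<close> on both sides cancel, and
      \<open>u p = 1\<close> leaves \<open>w f\<close> alone.\<close>
    ultimately have "w f = w (\<lambda>q. \<Sum>b\<in>Basis. E (?x b) q * E (G b) q)"
      by simp
    also have "\<dots> = (\<Sum>b\<in>Basis. w (\<lambda>q. E (?x b) q * E (G b) q))"
      by (intro tangent_space_sum[OF A w] prod)
    also have "\<dots> = (\<Sum>b\<in>Basis. w (E (?x b)) * frechet_derivative (?loc f) (at a) b)"
    proof (rule sum.cong)
      fix b :: 'a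
      \<comment> \<open>The centred coordinate vanishes at \<open>p\<close>, so only one term of the
        Leibniz rule survives, and there \<open>G b\<close> takes the value of the partial
        derivative at \<open>a\<close>.\<close>
      have "w (\<lambda>q. E (?x b) q * E (G b) q) = E (?x b) p * w (E (G b)) + E (G b) p * w (E (?x b))"
        by (rule tangent_spaceD(4)[OF w E_smooth[OF x_smooth] E_smooth[OF G(1)]])
      then show "w (\<lambda>q. E (?x b) q * E (G b) q) = w (E (?x b)) * frechet_derivative (?loc f) (at a) b"
        by (simp add: E_p G(3))
    qed simp
    also have "\<dots> = frechet_derivative (?loc f) (at a) e"
    proof -
      have "a \<in> ball a R" using \<open>0 < R\<close> by simp
      then have lin: "linear (frechet_derivative (?loc f) (at a))"
        using smooth_on_has_derivative[OF loc_smooth[OF f]] has_derivative_linear by blast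
      show ?thesis
        by (simp only: e_def linear_sum[OF lin] linear_scale[OF lin] real_scaleR_def)
    qed
    finally show ?thesis .
  qed
  \<comment> \<open>The value 0 on functions that are not smooth is the convention built into
    \<open>tangent_space\<close>.\<close>
  define Y where "Y q f = (if f \<in> smooth_functions A
      then E (\<lambda>x. frechet_derivative (?loc f) (at x) e) q else 0)" for q f
  have Y_eq: "Y q f = (if q \<in> U \<and> c q \<in> ball a R
      then \<psi> (c q) * frechet_derivative (?loc f) (at (c q)) e else 0)"
    if "f \<in> smooth_functions A" for q f
    using that E_outside[of q] by (auto simp: Y_def E_in)
  have "Y q \<in> tangent_space A q" for q
    unfolding tangent_space_def
  proof (intro CollectI conjI allI impI ballI)
    fix f assume "f \<notin> smooth_functions A"
    then show "Y q f = 0" by (simp add: Y_def)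
  next
    fix f h assume f: "f \<in> smooth_functions A" and h: "h \<in> smooth_functions A"
    note S = smooth_functions_add[OF A f h] smooth_functions_mult[OF A f h]
    have D: "(?loc f has_derivative frechet_derivative (?loc f) (at y)) (at y)"
      "(?loc h has_derivative frechet_derivative (?loc h) (at y)) (at y)" if "y \<in> ball a R" for y
      using smooth_on_has_derivative loc_smooth f h that by blast+
    show "Y q (\<lambda>q. f q + h q) = Y q f + Y q h"
    proof (cases "q \<in> U \<and> c q \<in> ball a R")
      case True
      have "(?loc (\<lambda>q. f q + h q) has_derivative (\<lambda>v. frechet_derivative (?loc f) (at (c q)) v
          + frechet_derivative (?loc h) (at (c q)) v)) (at (c q))"
        using has_derivative_add[OF D] True by (simp add: o_def)
      from fun_cong[OF frechet_derivative_at[OF this], of e, symmetric] show ?thesis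
        using True by (simp add: Y_eq f h S algebra_simps)
    qed (auto simp: Y_eq f h S)
    show "Y q (\<lambda>q. f q * h q) = f q * Y q h + h q * Y q f"
    proof (cases "q \<in> U \<and> c q \<in> ball a R")
      case True
      have "(?loc (\<lambda>q. f q * h q) has_derivative (\<lambda>v. f q * frechet_derivative (?loc h) (at (c q)) v
          + frechet_derivative (?loc f) (at (c q)) v * h q)) (at (c q))"
        using has_derivative_mult[OF D(1)[of "c q"] D(2)[of "c q"]] True loc[of q f] loc[of q h] by (simp add: o_def)
      from fun_cong[OF frechet_derivative_at[OF this], of e, symmetric] show ?thesis
        using True by (simp add: Y_eq f h S algebra_simps)
    qed (auto simp: Y_eq f h S)
  next
    fix k f assume f: "f \<in> smooth_functions A"
    note S = smooth_functions_mult[OF A smooth_functions_const[OF A] f]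
    show "Y q (\<lambda>q. k * f q) = k * Y q f"
    proof (cases "q \<in> U \<and> c q \<in> ball a R")
      case True
      then have "(?loc f has_derivative frechet_derivative (?loc f) (at (c q))) (at (c q))"
        using smooth_on_has_derivative loc_smooth f by blast
      then have "(?loc (\<lambda>q. k * f q) has_derivative (\<lambda>v. k * frechet_derivative (?loc f) (at (c q)) v)) (at (c q))"
        using has_derivative_mult_right by (simp add: o_def)
      from fun_cong[OF frechet_derivative_at[OF this], of e, symmetric] show ?thesis
        using True by (simp add: Y_eq f S algebra_simps)
    qed (auto simp: Y_eq f S)
  qed
  moreover have "(\<lambda>q. Y q f) \<in> smooth_functions A" if "f \<in> smooth_functions A" for f
    using E_smooth[OF smooth_on_frechet_derivative[OF loc_smooth[OF that]]] that by (simp add: Y_def)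
  ultimately have "Y \<in> vector_fields A" by (auto simp: vector_fields_def)
  moreover have "Y p = w"
  proof
    fix f
    show "Y p f = w f"
      using key[of f] tangent_spaceD(1)[OF w, of f] by (auto simp: Y_def E_p)
  qed
  ultimately show ?thesis by (rule that)
qed

text \<open>The Leibniz rule for 1 = 1 * 1 gives v(1) = 2 v(1), hence v(1) = 0.\<close>

lemma tangent_space_const:
  assumes "smooth_atlas A" "v \<in> tangent_space A p"
  shows "v (\<lambda>q. k) = 0"
proof -
  have "v (\<lambda>q. 1 * 1) = 1 * v (\<lambda>q. 1) + 1 * v (\<lambda>q. 1)"
    by (rule tangent_spaceD(4)[OF assms(2)]) (rule smooth_functions_const[OF assms(1)])+
  then have "v (\<lambda>q. 1) = 0" by simp
  then show ?thesis
    using tangent_spaceD(3)[OF assms(2) smooth_functions_const[OF assms(1)], of k 1] by simp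
qed

section \<open>Linear structure on tangent vectors and vector fields\<close>

lemma tangent_space_add:
  assumes "v \<in> tangent_space A p" "w \<in> tangent_space A p"
  shows "v + w \<in> tangent_space A p"
  using tangent_spaceD[OF assms(1)] tangent_spaceD[OF assms(2)]
  by (simp add: tangent_space_def algebra_simps)

lemma tangent_space_scale:
  assumes "v \<in> tangent_space A p"
  shows "a *\<^sub>T v \<in> tangent_space A p"
  using tangent_spaceD[OF assms]
  by (simp add: tangent_space_def tscale_def algebra_simps)

lemma fscale_apply [simp]: "(h *\<^sub>F X) p f = h p * X p f"
  by (simp add: fscale_def tscale_def)

lemma vector_fieldsD:
  assumes "X \<in> vector_fields A"
  shows "X p \<in> tangent_space A p"
    and "f \<in> smooth_functions A \<Longrightarrow> (\<lambda>p. X p f) \<in> smooth_functions A"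
  using assms by (auto simp: vector_fields_def)

lemma vector_fieldsI:
  assumes "\<And>p. X p \<in> tangent_space A p"
    and "\<And>f. f \<in> smooth_functions A \<Longrightarrow> (\<lambda>p. X p f) \<in> smooth_functions A"
  shows "X \<in> vector_fields A"
  using assms by (auto simp: vector_fields_def)

lemma vector_fields_add:
  assumes "smooth_atlas A" "X \<in> vector_fields A" "Y \<in> vector_fields A"
  shows "X + Y \<in> vector_fields A"
  using assms
  by (intro vector_fieldsI)
    (simp_all add: tangent_space_add vector_fieldsD smooth_functions_add)

lemma vector_fields_scale:
  assumes "smooth_atlas A" "h \<in> smooth_functions A" "X \<in> vector_fields A"
  shows "h *\<^sub>F X \<in> vector_fields A"
proof (rule vector_fieldsI)
  show "(h *\<^sub>F X) p \<in> tangent_space A p" for p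
    unfolding fscale_def by (intro tangent_space_scale vector_fieldsD(1)[OF assms(3)])
  show "(\<lambda>p. (h *\<^sub>F X) p f) \<in> smooth_functions A" if "f \<in> smooth_functions A" for f
    by (simp add: smooth_functions_mult assms vector_fieldsD(2)[OF assms(3)] that)
qed

text \<open>Reduces negation to scaling by a constant function, so that additivity and homogeneity
  suffice for all rules about negatives and differences.\<close>

lemma vfield_uminus: "- X = (\<lambda>p. -1) *\<^sub>F (X :: 'm vfield)"
  by (intro ext) simp

lemma vfield_diff: "X - Y = X + (\<lambda>p. -1) *\<^sub>F (Y :: 'm vfield)"
  by (intro ext) simp

section \<open>The Levi-Civita connection of an almost contact Norden structure\<close>

locale almost_contact_norden_levi_civita =
  fixes A :: "('m::{t2_space, second_countable_topology}, 'a::euclidean_space) atlas"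
    and n :: nat
    and \<phi> :: "'m \<Rightarrow> 'm tvec \<Rightarrow> 'm tvec"
    and \<xi> :: "'m vfield"
    and \<eta> :: "'m \<Rightarrow> 'm tvec \<Rightarrow> real"
    and g :: "'m \<Rightarrow> 'm tvec \<Rightarrow> 'm tvec \<Rightarrow> real"
    and nabla :: "'m vfield \<Rightarrow> 'm vfield \<Rightarrow> 'm vfield"
  assumes norden_structure: "almost_contact_norden n A \<phi> \<xi> \<eta> g"
    and levi_civita: "levi_civita A g nabla"
begin

abbreviation S where "S \<equiv> smooth_functions A"
abbreviation V where "V \<equiv> vector_fields A"
abbreviation G where "G \<equiv> tensor_app2 g"
abbreviation D\<phi> where "D\<phi> \<equiv> cov_endo nabla \<phi>"
abbreviation D\<eta> where "D\<eta> \<equiv> cov_form nabla \<eta>"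

lemma atlas: "smooth_atlas A" and endo: "endomorphism_field A \<phi>" and form: "one_form A \<eta>"
  and metric: "pseudo_riemannian_metric A g" and xi [simp]: "\<xi> \<in> V"
  and phi_phi: "x \<in> V \<Longrightarrow> \<phi> \<cdot> \<phi> \<cdot> x = - x + (\<eta> \<cdot> x) *\<^sub>F \<xi>"
  and eta_xi [simp]: "\<eta> \<cdot> \<xi> = (\<lambda>p. 1)"
  and norden: "x \<in> V \<Longrightarrow> y \<in> V \<Longrightarrow> G (\<phi> \<cdot> x) (\<phi> \<cdot> y) = - G x y + (\<eta> \<cdot> x) * (\<eta> \<cdot> y)"
  using norden_structure unfolding almost_contact_norden_def by blast+

lemma connection: "linear_connection A nabla"
  and torsion_free: "x \<in> V \<Longrightarrow> y \<in> V \<Longrightarrow> torsion nabla x y = 0"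
  and metric_compatible: "x \<in> V \<Longrightarrow> y \<in> V \<Longrightarrow> z \<in> V \<Longrightarrow>
    (\<lambda>p. x p (G y z)) = G (nabla x y) z + G y (nabla x z)"
  using levi_civita unfolding levi_civita_def symmetric_connection_def by blast+

text \<open>The calculus rules below hold only for smooth arguments; as simp rules, this lemma and
  \<open>V_closed\<close> discharge these side conditions.\<close>

lemma S_closed [simp]:
  "(\<lambda>q. k) \<in> S"
  "f \<in> S \<Longrightarrow> h \<in> S \<Longrightarrow> f + h \<in> S"
  "f \<in> S \<Longrightarrow> h \<in> S \<Longrightarrow> f - h \<in> S"
  "f \<in> S \<Longrightarrow> h \<in> S \<Longrightarrow> f * h \<in> S"
  "x \<in> V \<Longrightarrow> f \<in> S \<Longrightarrow> (\<lambda>p. x p f) \<in> S"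
proof -
  show "(\<lambda>q. k) \<in> S" for k by (rule smooth_functions_const[OF atlas])
  then show "f - h \<in> S" if "f \<in> S" "h \<in> S" for f h
    using smooth_functions_add[OF atlas that(1) smooth_functions_mult[OF atlas _ that(2)], of "\<lambda>_. -1"]
    by (simp add: fun_diff_def)
qed (simp_all add: smooth_functions_add[OF atlas] smooth_functions_mult[OF atlas]
    func_plus func_times vector_fieldsD)

lemma V_closed [simp]:
  "0 \<in> V"
  "x \<in> V \<Longrightarrow> y \<in> V \<Longrightarrow> x + y \<in> V"
  "f \<in> S \<Longrightarrow> x \<in> V \<Longrightarrow> f *\<^sub>F x \<in> V"
  "x \<in> V \<Longrightarrow> - x \<in> V"
  "x \<in> V \<Longrightarrow> y \<in> V \<Longrightarrow> x - y \<in> V"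
  "x \<in> V \<Longrightarrow> \<phi> \<cdot> x \<in> V"
  "x \<in> V \<Longrightarrow> y \<in> V \<Longrightarrow> nabla x y \<in> V"
  "x \<in> V \<Longrightarrow> y \<in> V \<Longrightarrow> D\<phi> x y \<in> V"
proof -
  note add = vector_fields_add[OF atlas] and scale = vector_fields_scale[OF atlas]
  show "x + y \<in> V" if "x \<in> V" "y \<in> V" for x y using add that .
  show "f *\<^sub>F x \<in> V" if "f \<in> S" "x \<in> V" for f x using scale that .
  show "- x \<in> V" if "x \<in> V" for x
    unfolding vfield_uminus by (intro scale that S_closed)
  show diff: "x - y \<in> V" if "x \<in> V" "y \<in> V" for x y
    unfolding vfield_diff[of x y] by (intro add scale that S_closed)
  show "0 \<in> V" using diff[OF xi xi] by simp
  show phi: "\<phi> \<cdot> x \<in> V" if "x \<in> V" for x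
    using endo that unfolding endomorphism_field_def by blast
  show nab: "nabla x y \<in> V" if "x \<in> V" "y \<in> V" for x y
    using connection that unfolding linear_connection_def by blast
  show "D\<phi> x y \<in> V" if "x \<in> V" "y \<in> V" for x y
    unfolding cov_endo_def by (intro diff nab phi that)
qed

lemma eta_closed [simp]: "x \<in> V \<Longrightarrow> \<eta> \<cdot> x \<in> S"
  using form by (simp add: one_form_def)

lemma D\<eta>_closed [simp]: "x \<in> V \<Longrightarrow> y \<in> V \<Longrightarrow> D\<eta> x y \<in> S"
  by (simp add: cov_form_def)

section \<open>Linearity of \<phi>, \<eta> and g over the smooth functions\<close>

lemma phi_add: "x \<in> V \<Longrightarrow> y \<in> V \<Longrightarrow> \<phi> \<cdot> (x + y) = \<phi> \<cdot> x + \<phi> \<cdot> y"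
  using endo by (intro ext) (simp add: tensor_app_def endomorphism_field_def vector_fieldsD)

lemma phi_scale: "x \<in> V \<Longrightarrow> \<phi> \<cdot> (h *\<^sub>F x) = h *\<^sub>F (\<phi> \<cdot> x)"
  using endo by (intro ext) (simp add: tensor_app_def fscale_def endomorphism_field_def vector_fieldsD)

lemma phi_uminus: "x \<in> V \<Longrightarrow> \<phi> \<cdot> (- x) = - (\<phi> \<cdot> x)"
  unfolding vfield_uminus by (rule phi_scale)

lemma phi_diff: "x \<in> V \<Longrightarrow> y \<in> V \<Longrightarrow> \<phi> \<cdot> (x - y) = \<phi> \<cdot> x - \<phi> \<cdot> y"
  by (simp add: vfield_diff[of x y] vfield_diff[of "\<phi> \<cdot> x" "\<phi> \<cdot> y"] phi_add phi_scale)

lemma phi_zero: "\<phi> \<cdot> 0 = 0"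
  using phi_diff[OF xi xi] by simp

lemma eta_add: "x \<in> V \<Longrightarrow> y \<in> V \<Longrightarrow> \<eta> \<cdot> (x + y) = \<eta> \<cdot> x + \<eta> \<cdot> y"
  using form by (intro ext) (simp add: tensor_app_def one_form_def vector_fieldsD)

lemma eta_scale: "x \<in> V \<Longrightarrow> \<eta> \<cdot> (h *\<^sub>F x) = h * (\<eta> \<cdot> x)"
  using form by (intro ext) (simp add: tensor_app_def fscale_def one_form_def vector_fieldsD)

lemma eta_diff: "x \<in> V \<Longrightarrow> y \<in> V \<Longrightarrow> \<eta> \<cdot> (x - y) = \<eta> \<cdot> x - \<eta> \<cdot> y"
  unfolding vfield_diff[of x y] by (intro ext) (simp add: eta_add eta_scale)

lemma G_add: "x \<in> V \<Longrightarrow> y \<in> V \<Longrightarrow> z \<in> V \<Longrightarrow> G (x + y) z = G x z + G y z"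
  using metric
  by (intro ext) (simp add: tensor_app2_def pseudo_riemannian_metric_def vector_fieldsD)

lemma G_scale: "x \<in> V \<Longrightarrow> z \<in> V \<Longrightarrow> G (h *\<^sub>F x) z = h * G x z"
  using metric
  by (intro ext) (simp add: tensor_app2_def fscale_def pseudo_riemannian_metric_def vector_fieldsD)

lemma G_diff: "x \<in> V \<Longrightarrow> y \<in> V \<Longrightarrow> z \<in> V \<Longrightarrow> G (x - y) z = G x z - G y z"
  unfolding vfield_diff[of x y] by (intro ext) (simp add: G_add G_scale)

lemma G_commute: "x \<in> V \<Longrightarrow> y \<in> V \<Longrightarrow> G x y = G y x"
  using metric by (intro ext) (simp add: tensor_app2_def pseudo_riemannian_metric_def vector_fieldsD)

text \<open>Nondegeneracy at \<open>p\<close> must be tested on all tangent vectors at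
  \<open>p\<close>, and each of them is the value of some vector field by the extension
  theorem.\<close>

lemma G_nondegenerate:
  assumes x: "x \<in> V" and "\<And>y. y \<in> V \<Longrightarrow> G x y = 0"
  shows "x = 0"
proof
  fix p
  have "g p (x p) w = 0" if w: "w \<in> tangent_space A p" for w
  proof -
    obtain Y where "Y \<in> V" "Y p = w"
      using tangent_vector_extends_to_vector_field[OF atlas w] .
    with fun_cong[OF assms(2), of Y p] show ?thesis by (simp add: tensor_app2_def)
  qed
  moreover have "\<forall>v\<in>tangent_space A p. (\<forall>w\<in>tangent_space A p. g p v w = 0) \<longrightarrow> v = 0"
    using metric unfolding pseudo_riemannian_metric_def by blast
  ultimately show "x p = 0 p"
    using vector_fieldsD(1)[OF x, of p] by simp
qed

lemma derivation_const: "x \<in> V \<Longrightarrow> x p (\<lambda>q. k) = 0"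
  by (rule tangent_space_const[OF atlas vector_fieldsD(1)])

section \<open>Linearity rules for \<nabla>, \<nabla>\<phi> and \<nabla>\<eta>\<close>

lemma nabla_add_left:
  "x \<in> V \<Longrightarrow> y \<in> V \<Longrightarrow> z \<in> V \<Longrightarrow> nabla (x + y) z = nabla x z + nabla y z"
  and nabla_scale_left: "h \<in> S \<Longrightarrow> x \<in> V \<Longrightarrow> y \<in> V \<Longrightarrow> nabla (h *\<^sub>F x) y = h *\<^sub>F nabla x y"
  and nabla_add_right:
  "x \<in> V \<Longrightarrow> y \<in> V \<Longrightarrow> z \<in> V \<Longrightarrow> nabla x (y + z) = nabla x y + nabla x z"
  and nabla_scale_right: "h \<in> S \<Longrightarrow> x \<in> V \<Longrightarrow> y \<in> V \<Longrightarrow>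
    nabla x (h *\<^sub>F y) = (\<lambda>p. x p h) *\<^sub>F y + h *\<^sub>F nabla x y"
  using connection unfolding linear_connection_def by blast+

lemma nabla_uminus_left: "x \<in> V \<Longrightarrow> y \<in> V \<Longrightarrow> nabla (- x) y = - nabla x y"
  unfolding vfield_uminus by (rule nabla_scale_left) auto

lemma nabla_zero_left: "y \<in> V \<Longrightarrow> nabla 0 y = 0"
  using nabla_add_left[of \<xi> "- \<xi>" y] by (simp add: nabla_uminus_left)

lemma nabla_diff_right:
  "x \<in> V \<Longrightarrow> y \<in> V \<Longrightarrow> z \<in> V \<Longrightarrow> nabla x (y - z) = nabla x y - nabla x z"
  unfolding vfield_diff[of y z]
  by (intro ext) (simp add: nabla_add_right nabla_scale_right derivation_const)

lemma nabla_zero_right: "x \<in> V \<Longrightarrow> nabla x 0 = 0"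
  using nabla_diff_right[of x \<xi> \<xi>] by simp

lemma D\<phi>_add_left: "x \<in> V \<Longrightarrow> y \<in> V \<Longrightarrow> z \<in> V \<Longrightarrow> D\<phi> (x + y) z = D\<phi> x z + D\<phi> y z"
  by (simp add: cov_endo_def nabla_add_left phi_add)

lemma D\<phi>_scale_left: "h \<in> S \<Longrightarrow> x \<in> V \<Longrightarrow> y \<in> V \<Longrightarrow> D\<phi> (h *\<^sub>F x) y = h *\<^sub>F D\<phi> x y"
  by (intro ext) (simp add: cov_endo_def nabla_scale_left phi_scale algebra_simps)

lemma D\<phi>_add_right: "x \<in> V \<Longrightarrow> y \<in> V \<Longrightarrow> z \<in> V \<Longrightarrow> D\<phi> x (y + z) = D\<phi> x y + D\<phi> x z"
  by (simp add: cov_endo_def nabla_add_right phi_add)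

lemma D\<phi>_scale_right: "h \<in> S \<Longrightarrow> x \<in> V \<Longrightarrow> y \<in> V \<Longrightarrow> D\<phi> x (h *\<^sub>F y) = h *\<^sub>F D\<phi> x y"
  by (intro ext) (simp add: cov_endo_def nabla_scale_right phi_scale phi_add algebra_simps)

lemma D\<eta>_add_left: "x \<in> V \<Longrightarrow> y \<in> V \<Longrightarrow> z \<in> V \<Longrightarrow> D\<eta> (x + y) z = D\<eta> x z + D\<eta> y z"
  by (intro ext) (simp add: cov_form_def nabla_add_left eta_add)

lemma D\<eta>_scale_left: "h \<in> S \<Longrightarrow> x \<in> V \<Longrightarrow> y \<in> V \<Longrightarrow> D\<eta> (h *\<^sub>F x) y = h * D\<eta> x y"
  by (intro ext) (simp add: cov_form_def nabla_scale_left eta_scale algebra_simps)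

section \<open>Algebraic consequences of the structure equations\<close>

lemma eta_scale_phi_xi:
  assumes "x \<in> V"
  shows "(\<eta> \<cdot> x) *\<^sub>F (\<phi> \<cdot> \<xi>) = (\<eta> \<cdot> \<phi> \<cdot> x) *\<^sub>F \<xi>"
proof -
  \<comment> \<open>The cube of \<phi> is computed twice: here as \<phi> applied to \<phi>(\<phi>
    x), afterwards as the square of \<phi> applied to \<phi> x.\<close>
  have "\<phi> \<cdot> \<phi> \<cdot> \<phi> \<cdot> x = - (\<phi> \<cdot> x) + (\<eta> \<cdot> x) *\<^sub>F (\<phi> \<cdot> \<xi>)"
    using assms by (simp only: phi_phi phi_add phi_uminus phi_scale V_closed eta_closed xi)
  then show ?thesis
    using assms phi_phi[of "\<phi> \<cdot> x"] by simp
qed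

text \<open>The preceding identity at \<xi> makes \<phi> \<xi> a multiple k \<xi>. The structure
  equation gives \<phi>(\<phi> \<xi>) = 0, so k^2 \<xi> = 0, and applying \<eta> yields k^2 =
  0.\<close>

lemma phi_xi: "\<phi> \<cdot> \<xi> = 0"
proof -
  define k where "k = \<eta> \<cdot> \<phi> \<cdot> \<xi>"
  have eq: "\<phi> \<cdot> \<xi> = k *\<^sub>F \<xi>"
    using eta_scale_phi_xi[OF xi] by (simp add: k_def fun_eq_iff)
  have "\<phi> \<cdot> \<phi> \<cdot> \<xi> = 0"
    by (intro ext) (simp add: phi_phi)
  moreover have "\<phi> \<cdot> \<phi> \<cdot> \<xi> = k *\<^sub>F k *\<^sub>F \<xi>"
    unfolding eq phi_scale[OF xi] by (rule refl)
  ultimately have "\<eta> \<cdot> (k *\<^sub>F k *\<^sub>F \<xi>) = \<eta> \<cdot> 0"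
    by simp
  moreover have "k \<in> S" by (simp add: k_def)
  ultimately have "k p * k p = 0" for p
    using eta_diff[OF xi xi] by (simp add: eta_scale fun_eq_iff)
  then show ?thesis
    unfolding eq by (intro ext) simp
qed

lemma eta_phi: "x \<in> V \<Longrightarrow> \<eta> \<cdot> \<phi> \<cdot> x = 0"
proof -
  assume x: "x \<in> V"
  have "(\<eta> \<cdot> \<phi> \<cdot> x) *\<^sub>F \<xi> = 0"
    using eta_scale_phi_xi[OF x] by (simp add: phi_xi fun_eq_iff)
  then have "\<eta> \<cdot> ((\<eta> \<cdot> \<phi> \<cdot> x) *\<^sub>F \<xi>) = \<eta> \<cdot> 0" by simp
  then show "\<eta> \<cdot> \<phi> \<cdot> x = 0"
    using eta_diff[OF xi xi] by (simp add: eta_scale fun_eq_iff)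
qed

text \<open>The Norden identity with second argument \<xi>, whose left-hand side vanishes because
  \<phi> \<xi> = 0.\<close>

lemma eta_eq: "x \<in> V \<Longrightarrow> \<eta> \<cdot> x = G x \<xi>"
  using norden[of x \<xi>] G_diff[of \<xi> \<xi> "\<phi> \<cdot> x"] G_commute[of 0 "\<phi> \<cdot> x"]
  by (simp add: phi_xi fun_eq_iff)

text \<open>The Norden identity for \<phi> x and y. The \<eta>-terms drop out because \<eta>
  vanishes on the image of \<phi>.\<close>

lemma phi_self_adjoint: "x \<in> V \<Longrightarrow> y \<in> V \<Longrightarrow> G (\<phi> \<cdot> x) y = G x (\<phi> \<cdot> y)"
proof -
  assume x: "x \<in> V" and y: "y \<in> V"
  have "- G (\<phi> \<cdot> x) y = G (- x + (\<eta> \<cdot> x) *\<^sub>F \<xi>) (\<phi> \<cdot> y)"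
    using norden[of "\<phi> \<cdot> x" y] x y by (simp add: phi_phi eta_phi)
  also have "\<dots> = - G x (\<phi> \<cdot> y)"
    using x y eta_eq[of "\<phi> \<cdot> y"] G_commute[of "\<phi> \<cdot> y" \<xi>]
    by (intro ext) (simp add: vfield_uminus[of x] G_add G_scale eta_phi)
  finally show ?thesis by (simp add: fun_eq_iff)
qed

section \<open>First derivatives of the structure tensors\<close>

lemma eta_nabla_xi: "x \<in> V \<Longrightarrow> \<eta> \<cdot> nabla x \<xi> = 0"
proof
  fix p assume x: "x \<in> V"
  \<comment> \<open>Differentiating this constant length gives 2 g(\<nabla>\<open>\<^sub>x\<close>
    \<xi>, \<xi>) = 0.\<close>
  have "G \<xi> \<xi> = (\<lambda>p. 1)" using eta_eq[OF xi] by simp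
  then show "(\<eta> \<cdot> nabla x \<xi>) p = 0 p"
    using fun_cong[OF metric_compatible[OF x xi xi], of p] x G_commute[of "nabla x \<xi>" \<xi>]
    by (simp add: derivation_const eta_eq)
qed

text \<open>Obtained by differentiating \<eta>(y) = g(y, \<xi>). Symmetry of \<nabla>\<eta> thus
  means that the covariant derivative of \<xi> is a self-adjoint endomorphism.\<close>

lemma D\<eta>_eq: "x \<in> V \<Longrightarrow> y \<in> V \<Longrightarrow> D\<eta> x y = G (nabla x \<xi>) y"
  using metric_compatible[of x y \<xi>] G_commute[of y "nabla x \<xi>"]
  by (simp add: cov_form_def eta_eq)

text \<open>The covariant derivative of the structure equation for the square of \<phi>.\<close>

lemma phi_D\<phi>:
  assumes "x \<in> V" "y \<in> V"
  shows "\<phi> \<cdot> D\<phi> x y = D\<eta> x y *\<^sub>F \<xi> + (\<eta> \<cdot> y) *\<^sub>F nabla x \<xi> - D\<phi> x (\<phi> \<cdot> y)"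
  using assms
  by (intro ext) (simp add: cov_endo_def cov_form_def phi_diff phi_phi nabla_diff_right
      nabla_scale_right algebra_simps)

lemma lie_bracket_eq: "x \<in> V \<Longrightarrow> y \<in> V \<Longrightarrow> lie_bracket x y = nabla x y - nabla y x"
  using torsion_free by (simp add: torsion_def)

end

section \<open>The class with \<open>N = 0\<close> and \<open>d\<eta> = 0\<close>\<close>

locale almost_contact_norden_F12456 =
  almost_contact_norden_levi_civita A n \<phi> \<xi> \<eta> g nabla
  for A :: "('m::{t2_space, second_countable_topology}, 'a::euclidean_space) atlas"
    and n \<phi> \<xi> \<eta> g nabla +
  assumes F12456: "class_F12456 A nabla \<phi> \<xi> \<eta>"
begin

lemma nijenhuis_zero: "x \<in> V \<Longrightarrow> y \<in> V \<Longrightarrow> nijenhuis nabla \<phi> \<xi> \<eta> x y = 0"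
  and D\<eta>_commute: "x \<in> V \<Longrightarrow> y \<in> V \<Longrightarrow> D\<eta> x y = D\<eta> y x"
  using F12456 unfolding class_F12456_def by blast+

text \<open>Each bracket in N is replaced by a difference of covariant derivatives; these group into
  derivatives of \<phi>, and the \<xi>-term cancels because d\<eta> = 0.\<close>

lemma nijenhuis_D\<phi>:
  assumes "x \<in> V" "y \<in> V"
  shows "D\<phi> (\<phi> \<cdot> x) y - D\<phi> (\<phi> \<cdot> y) x - \<phi> \<cdot> D\<phi> x y + \<phi> \<cdot> D\<phi> y x = 0"
proof (intro ext)
  fix p f
  from nijenhuis_zero[OF assms] have "nijenhuis nabla \<phi> \<xi> \<eta> x y p f = 0" by simp
  then show "(D\<phi> (\<phi> \<cdot> x) y - D\<phi> (\<phi> \<cdot> y) x - \<phi> \<cdot> D\<phi> x y + \<phi> \<cdot> D\<phi> y x) p f = 0 p f"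
    using assms D\<eta>_commute[OF assms]
    by (simp add: nijenhuis_def lie_bracket_eq cov_endo_def phi_diff)
qed

lemma nabla_xi_commute: "x \<in> V \<Longrightarrow> y \<in> V \<Longrightarrow> G (nabla x \<xi>) y = G (nabla y \<xi>) x"
  using D\<eta>_commute by (simp add: D\<eta>_eq)

text \<open>The symmetry from d\<eta> = 0 turns g(\<nabla>\<open>\<^sub>\<xi>\<close> \<xi>, y) into
  \<eta>(\<nabla>\<open>\<^sub>y\<close> \<xi>), which is zero since \<xi> has constant
  length.\<close>

lemma nabla_xi_xi: "nabla \<xi> \<xi> = 0"
proof (rule G_nondegenerate)
  fix y assume y: "y \<in> V"
  then show "G (nabla \<xi> \<xi>) y = 0"
    using nabla_xi_commute[OF xi y] eta_nabla_xi[OF y] by (simp add: eta_eq)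
qed simp

text \<open>N(x, \<xi>) = 0 only shows that \<phi> annihilates the difference \<open>z\<close> of
  the two sides. Once \<eta>(z) = 0 is also known, the structure equation gives 0 = \<phi>(\<phi> z)
  = -z.\<close>

lemma D\<phi>_xi_left_eq:
  assumes "x \<in> V"
  shows "D\<phi> \<xi> x = nabla (\<phi> \<cdot> x) \<xi> - \<phi> \<cdot> nabla x \<xi>"
proof -
  define z where "z = D\<phi> \<xi> x - (nabla (\<phi> \<cdot> x) \<xi> - \<phi> \<cdot> nabla x \<xi>)"
  have z: "z \<in> V" using assms by (simp add: z_def)
  \<comment> \<open>This handles the one summand of \<eta>(z) that is not already zero by
    \<open>eta_phi\<close> or \<open>eta_nabla_xi\<close>.\<close>
  have "D\<eta> \<xi> (\<phi> \<cdot> x) = 0"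
    using assms G_diff[OF xi xi, of "\<phi> \<cdot> x"] by (simp add: D\<eta>_eq nabla_xi_xi)
  then have "\<eta> \<cdot> nabla \<xi> (\<phi> \<cdot> x) = 0"
    using assms derivation_const[OF xi, of _ 0]
    by (simp add: cov_form_def eta_phi fun_eq_iff func_zero)
  then have eta_z: "\<eta> \<cdot> z = 0"
    using assms by (simp add: z_def cov_endo_def eta_diff eta_phi eta_nabla_xi)
  have "\<phi> \<cdot> z = D\<phi> (\<phi> \<cdot> x) \<xi> - D\<phi> (\<phi> \<cdot> \<xi>) x - \<phi> \<cdot> D\<phi> x \<xi> + \<phi> \<cdot> D\<phi> \<xi> x"
    using assms
    by (intro ext) (simp add: z_def cov_endo_def phi_diff phi_xi phi_zero nabla_zero_left
        nabla_zero_right phi_uminus)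
  then have "\<phi> \<cdot> z = 0"
    using nijenhuis_D\<phi>[OF assms xi] by simp
  then have "- z + (\<eta> \<cdot> z) *\<^sub>F \<xi> = 0"
    using phi_phi[OF z] by (simp add: phi_zero)
  then have "z = 0"
    by (simp add: eta_z fun_eq_iff)
  then show ?thesis by (simp add: z_def)
qed

text \<open>Differentiate g(\<phi> x, y) = g(x, \<phi> y) along z; self-adjointness of \<phi>
  removes the terms in which x or y is differentiated.\<close>

lemma D\<phi>_self_adjoint:
  assumes "x \<in> V" "y \<in> V" "z \<in> V"
  shows "G (D\<phi> z x) y = G x (D\<phi> z y)"
proof (intro ext)
  fix p
  have "G (\<phi> \<cdot> x) y = G x (\<phi> \<cdot> y)"
    by (rule phi_self_adjoint[OF assms(1,2)])
  then have "z p (G (\<phi> \<cdot> x) y) = z p (G x (\<phi> \<cdot> y))" by simp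
  then show "G (D\<phi> z x) y p = G x (D\<phi> z y) p"
    using assms fun_cong[OF metric_compatible[of z "\<phi> \<cdot> x" y], of p]
      fun_cong[OF metric_compatible[of z x "\<phi> \<cdot> y"], of p]
      G_commute[of x "D\<phi> z y"] G_commute[of x "nabla z (\<phi> \<cdot> y)"] G_commute[of x "\<phi> \<cdot> nabla z y"]
      phi_self_adjoint[of "nabla z x" y] phi_self_adjoint[of x "nabla z y"]
    by (simp add: cov_endo_def G_diff)
qed

lemma D\<phi>_xi_left:
  assumes x: "x \<in> V"
  shows "D\<phi> \<xi> x = 0"
proof (rule G_nondegenerate)
  fix y assume y: "y \<in> V"
  have eq: "G (D\<phi> \<xi> u) v = G (nabla (\<phi> \<cdot> u) \<xi>) v - G (nabla u \<xi>) (\<phi> \<cdot> v)" if "u \<in> V" "v \<in> V" for u v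
    using that by (simp add: D\<phi>_xi_left_eq G_diff phi_self_adjoint)
  have "G (D\<phi> \<xi> x) y = G (D\<phi> \<xi> y) x"
    using x y D\<phi>_self_adjoint[OF x y xi] G_commute[of x "D\<phi> \<xi> y"] by simp
  \<comment> \<open>By \<open>eq\<close> and d\<eta> = 0, exchanging x and y changes the sign, while
    the preceding fact says that it changes nothing.\<close>
  then show "G (D\<phi> \<xi> x) y = 0"
    using x y nabla_xi_commute[of "\<phi> \<cdot> x" y] nabla_xi_commute[of x "\<phi> \<cdot> y"]
    by (simp add: eq fun_eq_iff)
qed (use x in simp)

lemma nabla_phi_xi: "x \<in> V \<Longrightarrow> nabla (\<phi> \<cdot> x) \<xi> = \<phi> \<cdot> nabla x \<xi>"
  using D\<phi>_xi_left_eq D\<phi>_xi_left by (metis eq_iff_diff_eq_0)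

lemma D\<eta>_phi: "x \<in> V \<Longrightarrow> y \<in> V \<Longrightarrow> D\<eta> (\<phi> \<cdot> x) y = D\<eta> x (\<phi> \<cdot> y)"
  by (simp add: D\<eta>_eq nabla_phi_xi phi_self_adjoint)

section \<open>The difference tensor of the two connections\<close>

definition B :: "'m vfield \<Rightarrow> 'm vfield \<Rightarrow> 'm vfield" where
  "B x y = (\<lambda>p. 2) *\<^sub>F D\<phi> x (\<phi> \<cdot> y) + D\<phi> y (\<phi> \<cdot> x) - D\<phi> (\<phi> \<cdot> y) x
     + (\<lambda>p. 2) *\<^sub>F D\<eta> x y *\<^sub>F \<xi> - (\<lambda>p. 3) *\<^sub>F (\<eta> \<cdot> x) *\<^sub>F nabla y \<xi>
     - (\<lambda>p. 4) *\<^sub>F (\<eta> \<cdot> y) *\<^sub>F nabla x \<xi>"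

lemma B_closed [simp]: "x \<in> V \<Longrightarrow> y \<in> V \<Longrightarrow> B x y \<in> V"
  by (simp add: B_def)

text \<open>After \<open>phi_D\<phi>\<close> is inserted, the difference of the two sides is the
  left-hand side of \<open>nijenhuis_D\<phi>\<close>. The coefficients 3 and 4 differ by one so as
  to supply its \<eta>-terms.\<close>

lemma B_commute:
  assumes "x \<in> V" "y \<in> V"
  shows "B x y = B y x"
proof (intro ext)
  fix p f
  show "B x y p f = B y x p f"
    using assms fun_cong[OF fun_cong[OF nijenhuis_D\<phi>[OF assms], of p], of f]
      D\<eta>_commute[OF assms]
    by (simp add: B_def phi_D\<phi> algebra_simps)
qed

text \<open>Linearity is proved in the first argument only; \<open>B_commute\<close> carries it over
  to the second.\<close>

lemma B_add_left: "x \<in> V \<Longrightarrow> y \<in> V \<Longrightarrow> z \<in> V \<Longrightarrow> B (x + y) z = B x z + B y z"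
  by (intro ext) (simp add: B_def phi_add eta_add nabla_add_left D\<phi>_add_left D\<phi>_add_right
      D\<eta>_add_left algebra_simps)

lemma B_scale_left: "h \<in> S \<Longrightarrow> x \<in> V \<Longrightarrow> y \<in> V \<Longrightarrow> B (h *\<^sub>F x) y = h *\<^sub>F B x y"
  by (intro ext) (simp add: B_def phi_scale eta_scale nabla_scale_left D\<phi>_scale_left
      D\<phi>_scale_right D\<eta>_scale_left algebra_simps)

text \<open>A fixed representative of \<nabla>'. The theorem prescribes \<nabla>' on smooth fields
  only, so the claims are first proved for this one.\<close>

definition nabla_phi :: "'m vfield \<Rightarrow> 'm vfield \<Rightarrow> 'm vfield" where
  "nabla_phi x y = nabla x y + (\<lambda>p. 1/4) *\<^sub>F B x y"

lemma nabla_phi_closed [simp]: "x \<in> V \<Longrightarrow> y \<in> V \<Longrightarrow> nabla_phi x y \<in> V"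
  by (simp add: nabla_phi_def)

lemma linear_connection_nabla_phi: "linear_connection A nabla_phi"
proof -
  have "nabla_phi (x + y) z = nabla_phi x z + nabla_phi y z" if "x \<in> V" "y \<in> V" "z \<in> V" for x y z
    using that by (intro ext) (simp add: nabla_phi_def nabla_add_left B_add_left algebra_simps)
  moreover have "nabla_phi (h *\<^sub>F x) y = h *\<^sub>F nabla_phi x y" if "h \<in> S" "x \<in> V" "y \<in> V" for h x y
    using that by (intro ext) (simp add: nabla_phi_def nabla_scale_left B_scale_left algebra_simps)
  moreover have "nabla_phi x (y + z) = nabla_phi x y + nabla_phi x z"
    if "x \<in> V" "y \<in> V" "z \<in> V" for x y z
    using that by (intro ext)
      (simp add: nabla_phi_def nabla_add_right B_commute[of x] B_add_left algebra_simps)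
  moreover have "nabla_phi x (h *\<^sub>F y) = (\<lambda>p. x p h) *\<^sub>F y + h *\<^sub>F nabla_phi x y"
    if "h \<in> S" "x \<in> V" "y \<in> V" for h x y
    using that by (intro ext)
      (simp add: nabla_phi_def nabla_scale_right B_commute[of x] B_scale_left algebra_simps)
  ultimately show ?thesis
    unfolding linear_connection_def by simp
qed

lemma torsion_nabla_phi: "x \<in> V \<Longrightarrow> y \<in> V \<Longrightarrow> torsion nabla_phi x y = 0"
  by (intro ext) (simp add: torsion_def lie_bracket_eq nabla_phi_def B_commute[of x y])

text \<open>This is four times the equation \<nabla>'\<phi> = 0. After expansion by
  \<open>phi_D\<phi>\<close>, what remains are an \<xi>-term, a multiple of \<eta>(x)
  (\<nabla>\<open>\<^sub>\<phi>\<^sub>y\<close> \<xi> - \<phi> \<nabla>\<open>\<^sub>y\<close>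
  \<xi>) and \<eta>(y) (\<nabla>\<open>\<^sub>\<xi>\<close> \<phi>) x; they vanish by
  \<open>D\<eta>_phi\<close>, \<open>nabla_phi_xi\<close> and
  \<open>D\<phi>_xi_left\<close>.\<close>

lemma phi_B:
  assumes x: "x \<in> V" and y: "y \<in> V"
  shows "\<phi> \<cdot> B x y = (\<lambda>p. 4) *\<^sub>F D\<phi> x y + B x (\<phi> \<cdot> y)"
proof (intro ext)
  fix p f
  have D\<phi>_xi: "D\<phi> u \<xi> = (\<lambda>p. -1) *\<^sub>F (\<phi> \<cdot> nabla u \<xi>)" if "u \<in> V" for u
    using that nabla_diff_right[OF that xi xi] by (intro ext) (simp add: cov_endo_def phi_xi)
  \<comment> \<open>Negation is written as scaling by -1 so that the scaling rules of the
    derivatives apply during simplification.\<close>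
  have phi_phi': "\<phi> \<cdot> \<phi> \<cdot> u = (\<lambda>p. -1) *\<^sub>F u + (\<eta> \<cdot> u) *\<^sub>F \<xi>" if "u \<in> V" for u
    by (intro ext) (simp add: phi_phi that)
  show "(\<phi> \<cdot> B x y) p f = ((\<lambda>p. 4) *\<^sub>F D\<phi> x y + B x (\<phi> \<cdot> y)) p f"
    using x y D\<eta>_phi[OF y x]
    by (simp add: B_def phi_diff phi_add phi_scale phi_D\<phi> phi_phi' phi_xi D\<phi>_add_right
        D\<phi>_scale_right D\<phi>_add_left D\<phi>_scale_left D\<phi>_xi D\<phi>_xi_left eta_phi nabla_phi_xi
        algebra_simps)
qed

lemma cov_endo_nabla_phi: "x \<in> V \<Longrightarrow> y \<in> V \<Longrightarrow> cov_endo nabla_phi \<phi> x y = 0"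
  by (intro ext) (simp add: cov_endo_def nabla_phi_def phi_add phi_scale phi_B algebra_simps)

end

theorem theorem2p3:
  fixes A :: "('m::{t2_space, second_countable_topology}, 'a::euclidean_space) atlas"
    and n :: nat
    and \<phi> :: "'m \<Rightarrow> 'm tvec \<Rightarrow> 'm tvec"
    and \<xi> :: "'m vfield"
    and \<eta> :: "'m \<Rightarrow> 'm tvec \<Rightarrow> real"
    and g :: "'m \<Rightarrow> 'm tvec \<Rightarrow> 'm tvec \<Rightarrow> real"
    and nabla nabla' :: "'m vfield \<Rightarrow> 'm vfield \<Rightarrow> 'm vfield"
  assumes "almost_contact_norden n A \<phi> \<xi> \<eta> g"
    and "levi_civita A g nabla"
    and "class_F12456 A nabla \<phi> \<xi> \<eta>"
    and "\<forall>x\<in>vector_fields A. \<forall>y\<in>vector_fields A.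
      nabla' x y = nabla x y + (\<lambda>p. 1/4) *\<^sub>F
        ((\<lambda>p. 2) *\<^sub>F cov_endo nabla \<phi> x (\<phi> \<cdot> y)
         + cov_endo nabla \<phi> y (\<phi> \<cdot> x)
         - cov_endo nabla \<phi> (\<phi> \<cdot> y) x
         + (\<lambda>p. 2) *\<^sub>F cov_form nabla \<eta> x y *\<^sub>F \<xi>
         - (\<lambda>p. 3) *\<^sub>F (\<eta> \<cdot> x) *\<^sub>F nabla y \<xi>
         - (\<lambda>p. 4) *\<^sub>F (\<eta> \<cdot> y) *\<^sub>F nabla x \<xi>)"
  shows "symmetric_connection A nabla' \<and> almost_phi_connection A \<phi> nabla'"
proof -
  interpret almost_contact_norden_F12456 A n \<phi> \<xi> \<eta> g nabla
    by unfold_locales (fact assms)+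
  \<comment> \<open>Agreement on smooth fields is enough, since all the predicates quantify over
    such fields and \<phi> preserves them.\<close>
  have eq: "nabla' x y = nabla_phi x y" if "x \<in> V" "y \<in> V" for x y
    using assms(4) that by (simp add: nabla_phi_def B_def)
  have "linear_connection A nabla'"
    using linear_connection_nabla_phi unfolding linear_connection_def by (simp add: eq)
  moreover have "torsion nabla' x y = 0" if "x \<in> V" "y \<in> V" for x y
    using torsion_nabla_phi[OF that] that by (simp add: torsion_def eq)
  moreover have "cov_endo nabla' \<phi> x y = 0" if "x \<in> V" "y \<in> V" for x y
    using cov_endo_nabla_phi[OF that] that by (simp add: cov_endo_def eq)
  ultimately show ?thesis
    by (simp add: symmetric_connection_def almost_phi_connection_def)
qed

end
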